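(* In the additive Gaussian noise model of the context, with a signal actually present at $x_{\mathbf s}\in\chi$ and in the high signal-to-noise limit form of the log-likelihood ratio given there, the signal location estimate $x_{\mathbf m}$ (the maximizer of the log-likelihood ratio) has estimation error equal to the Cramér–Rao bound: $$\big\langle(x_{\mathbf m}-x_{\mathbf s})(x_{\mathbf m}-x_{\mathbf s})^*\big\rangle=r^{-2}(x_{\mathbf s})\,Q^{-1}(x_{\mathbf s}).$$ Moreover, the peak value $\lambda_{\mathbf m}=\lambda(x_{\mathbf m})$ exceeds $\lambda_{\mathbf s}=\lambda(x_{\mathbf s})$ by $\tfrac12 (x_{\mathbf m}-x_{\mathbf s})^*\,r^2(x_{\mathbf s})Q(x_{\mathbf s})\,(x_{\mathbf m}-x_{\mathbf s})$, which is one half of a chi-square variable with mean $d$ and variance $2d$, and $$\langle\lambda_{\mathbf m}\rangle=\langle\lambda_{\mathbf s}\rangle+\frac d2=\frac{r^2(x_{\mathbf s})}{2}+\frac d2 .$$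
   Context: Measurement model: $\mathbf m=\mathbf s(x_{\mathbf s})+\mathbf n$, where $\mathbf n$ is a Gaussian noise vector of mean zero and (positive definite) covariance $\mathbf C$. Here $\mathbf s(x)$ is a known smooth family of nonzero signals for $x$ in a $d$-dimensional continuous domain $\chi$. $\langle\cdot\rangle$ is expectation over $\mathbf n$, and an asterisk denotes transpose. Amplitude SNR: $r(x)=\big(\mathbf s^*(x)\mathbf C^{-1}\mathbf s(x)\big)^{1/2}$. Log-likelihood ratio (signal at $x'$ versus no signal): $\lambda(x')=\mathbf s^*(x')\mathbf C^{-1}\mathbf m-\tfrac12r^2(x')$. Normalized filter output $y(x)=\mathbf s^*(x)\mathbf C^{-1}\mathbf m/r(x)$. Curvature matrix $M_{ij}(x)=\big\langle\frac{\partial y}{\partial x_i}\frac{\partial y}{\partial x_j}\big\rangle$ computed with noise only ($\mathbf m=\mathbf n$), and $$Q_{ij}(x)=M_{ij}(x)+\frac{\partial\log r}{\partial x_i}\frac{\partial\log r}{\partial x_j},$$ assumed positive definite. High-SNR limit, standing approximation: let $\lambda_{\mathbf s}=\lambda(x_{\mathbf s})$ and let $\nabla\lambda_{\mathbf s}$ be the gradient vector of $\lambda(x')$ at $x'=x_{\mathbf s}$ (both random, computed from the exact log-likelihood ratio above). The log-likelihood ratio is replaced by its second-order expansion about $x_{\mathbf s}$, with the matrix of second derivatives replaced by its expected value $-r^2(x_{\mathbf s})Q(x_{\mathbf s})$: $$\lambda(x')=\lambda_{\mathbf s}+(x'-x_{\mathbf s})^*\nabla\lambda_{\mathbf s}-\frac{r^2(x_{\mathbf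 s})}{2}(x'-x_{\mathbf s})^*Q(x_{\mathbf s})(x'-x_{\mathbf s}),$$ with $x'$ ranging over $\mathbb R^d$. The estimate $x_{\mathbf m}$ is the maximizer of this expression. The Cramér–Rao bound is the inverse of the Fisher information matrix of the model $\mathbf m\sim N(\mathbf s(x),\mathbf C)$ at $x=x_{\mathbf s}$. *)

theory Defs
  imports "HOL-Probability.Probability"
begin

definition pos_def :: "real ^ 'n ^ 'n \<Rightarrow> bool" where
  "pos_def A \<longleftrightarrow> transpose A = A \<and> (\<forall>v. v \<noteq> 0 \<longrightarrow> v \<bullet> (A *v v) > 0)"

definition outer :: "real ^ 'n \<Rightarrow> real ^ 'n ^ 'n" where
  "outer v = (\<chi> i j. v $ i * v $ j)"

definition partial_deriv ::
  "'d \<Rightarrow> (real ^ 'd \<Rightarrow> 'b::real_normed_vector) \<Rightarrow> real ^ 'd \<Rightarrow> 'b" where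
  "partial_deriv i f x = vector_derivative (\<lambda>t. f (x + t *\<^sub>R axis i 1)) (at 0)"

definition grad :: "(real ^ 'd \<Rightarrow> real) \<Rightarrow> real ^ 'd \<Rightarrow> real ^ 'd" where
  "grad f x = (\<chi> i. partial_deriv i f x)"

(* Intended for open S. *)
primrec Ck_on ::
  "nat \<Rightarrow> (real ^ 'd) set \<Rightarrow> (real ^ 'd \<Rightarrow> 'b::real_normed_vector) \<Rightarrow> bool" where
  "Ck_on 0 S f \<longleftrightarrow> continuous_on S f"
| "Ck_on (Suc k) S f \<longleftrightarrow>
     (\<forall>x\<in>S. f differentiable (at x)) \<and> (\<forall>i. Ck_on k S (partial_deriv i f))"

definition smooth_on :: "(real ^ 'd) set \<Rightarrow> (real ^ 'd \<Rightarrow> 'b::real_normed_vector) \<Rightarrow> bool" where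
  "smooth_on S f \<longleftrightarrow> (\<forall>k. Ck_on k S f)"

text \<open>The distribution N(\<open>\<mu>\<close>, \<open>C\<close>) for a positive definite covariance matrix \<open>C\<close>.\<close>

definition gaussian_density :: "real ^ 'n \<Rightarrow> real ^ 'n ^ 'n \<Rightarrow> real ^ 'n \<Rightarrow> real" where
  "gaussian_density \<mu> C v =
     exp (- ((v - \<mu>) \<bullet> (matrix_inv C *v (v - \<mu>))) / 2) / sqrt ((2 * pi) ^ CARD('n) * det C)"

definition gaussian :: "real ^ 'n \<Rightarrow> real ^ 'n ^ 'n \<Rightarrow> (real ^ 'n) measure" where
  "gaussian \<mu> C = density lborel (\<lambda>v. ennreal (gaussian_density \<mu> C v))"

text \<open>The law of the sum of the squares of \<open>k\<close> independent standard normal variables.\<close>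

definition chi_square :: "nat \<Rightarrow> real measure" where
  "chi_square k =
     distr (\<Pi>\<^sub>M i\<in>{..<k}. density lborel (\<lambda>x. ennreal (std_normal_density x))) borel
       (\<lambda>z. \<Sum>i<k. (z i)\<^sup>2)"

text \<open>
  Throughout, \<open>C\<close> is the noise covariance, \<open>s\<close> the family of signals, and \<open>m\<close> a measured vector.
\<close>

definition snr :: "real ^ 'n ^ 'n \<Rightarrow> (real ^ 'd \<Rightarrow> real ^ 'n) \<Rightarrow> real ^ 'd \<Rightarrow> real" where
  "snr C s x = sqrt (s x \<bullet> (matrix_inv C *v s x))"

definition llr ::
  "real ^ 'n ^ 'n \<Rightarrow> (real ^ 'd \<Rightarrow> real ^ 'n) \<Rightarrow> real ^ 'n \<Rightarrow> real ^ 'd \<Rightarrow> real" where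
  "llr C s m x = s x \<bullet> (matrix_inv C *v m) - (snr C s x)\<^sup>2 / 2"

definition filter_output ::
  "real ^ 'n ^ 'n \<Rightarrow> (real ^ 'd \<Rightarrow> real ^ 'n) \<Rightarrow> real ^ 'n \<Rightarrow> real ^ 'd \<Rightarrow> real" where
  "filter_output C s m x = (s x \<bullet> (matrix_inv C *v m)) / snr C s x"

text \<open>The expectation is over noise-only measurements.\<close>

definition curvature ::
  "real ^ 'n ^ 'n \<Rightarrow> (real ^ 'd \<Rightarrow> real ^ 'n) \<Rightarrow> real ^ 'd \<Rightarrow> real ^ 'd ^ 'd" where
  "curvature C s x =
     (\<chi> i j. \<integral>n. partial_deriv i (filter_output C s n) x
                  * partial_deriv j (filter_output C s n) x \<partial>(gaussian 0 C))"

definition Q_matrix ::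
  "real ^ 'n ^ 'n \<Rightarrow> (real ^ 'd \<Rightarrow> real ^ 'n) \<Rightarrow> real ^ 'd \<Rightarrow> real ^ 'd ^ 'd" where
  "Q_matrix C s x = curvature C s x + outer (grad (\<lambda>x'. ln (snr C s x')) x)"

text \<open>
  The high-SNR form of the log-likelihood ratio around the true location \<open>xs\<close>. Its value and
  gradient at \<open>xs\<close> are those of the exact log-likelihood ratio, and it is a function on the whole
  of \<open>\<real>\<^sup>d\<close>.
\<close>

definition high_snr_llr ::
  "real ^ 'n ^ 'n \<Rightarrow> (real ^ 'd \<Rightarrow> real ^ 'n) \<Rightarrow> real ^ 'd \<Rightarrow> real ^ 'n \<Rightarrow> real ^ 'd \<Rightarrow> real" where
  "high_snr_llr C s xs m x =
     llr C s m xs + (x - xs) \<bullet> grad (llr C s m) xs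
     - (snr C s xs)\<^sup>2 / 2 * ((x - xs) \<bullet> (Q_matrix C s xs *v (x - xs)))"

definition location_estimate ::
  "real ^ 'n ^ 'n \<Rightarrow> (real ^ 'd \<Rightarrow> real ^ 'n) \<Rightarrow> real ^ 'd \<Rightarrow> real ^ 'n \<Rightarrow> real ^ 'd" where
  "location_estimate C s xs m = arg_max (high_snr_llr C s xs m) (\<lambda>_. True)"

definition fisher_information ::
  "real ^ 'n ^ 'n \<Rightarrow> (real ^ 'd \<Rightarrow> real ^ 'n) \<Rightarrow> real ^ 'd \<Rightarrow> real ^ 'd ^ 'd" where
  "fisher_information C s x =
     (\<integral>m. outer (grad (\<lambda>x'. ln (gaussian_density (s x') C m)) x) \<partial>(gaussian (s x) C))"

definition cramer_rao_bound ::
  "real ^ 'n ^ 'n \<Rightarrow> (real ^ 'd \<Rightarrow> real ^ 'n) \<Rightarrow> real ^ 'd \<Rightarrow> real ^ 'd ^ 'd" where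
  "cramer_rao_bound C s x = matrix_inv (fisher_information C s x)"

end

theory Submission
  imports Defs
begin

text \<open>
  Write \<open>K = C\<^sup>-\<^sup>1\<close>, and let \<open>e\<^sub>i\<close> be the partial derivatives of the signal at \<open>x\<^sub>s\<close>. Everything is
  governed by the Gram matrix \<open>F\<^sub>i\<^sub>j = e\<^sub>i \<bullet> K e\<^sub>j\<close>. In the gradient of the log-likelihood ratio at
  \<open>x\<^sub>s\<close> the signal part of the measurement cancels against the derivative of \<open>r\<^sup>2 / 2\<close>, so the gradient
  is \<open>g\<^sub>i = e\<^sub>i \<bullet> K n\<close>, linear in the noise, with covariance \<open>F\<close>. The score of the Gaussian model is
  the same vector, hence \<open>F\<close> is the Fisher information (\<open>fisher_information_eq_gram\<close>). The curvature
  matrix is \<open>r\<^sup>-\<^sup>2 F\<close> minus exactly the outer product of the gradient of \<open>log r\<close> that \<open>Q\<close> adds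
  back, so \<open>r\<^sup>2 Q = F\<close> as well (\<open>snr_Q_matrix_eq_gram\<close>).

  Completing the square (\<open>is_arg_max_concave_quadratic\<close>) gives the estimation error \<open>F\<^sup>-\<^sup>1 g\<close>, whose
  covariance is \<open>F\<^sup>-\<^sup>1 F F\<^sup>-\<^sup>1 = F\<^sup>-\<^sup>1\<close>, and the excess \<open>g \<bullet> F\<^sup>-\<^sup>1 g / 2\<close> of the peak over the value
  at \<open>x\<^sub>s\<close>. Geometrically, \<open>g \<bullet> F\<^sup>-\<^sup>1 g\<close> is the squared \<open>K\<close>-norm of the \<open>K\<close>-orthogonal projection of
  the noise onto the span of the \<open>e\<^sub>i\<close>. That span has dimension \<open>d\<close>, because \<open>F\<close> is positive definite.
  In a \<open>K\<close>-orthonormal basis with \<open>d\<close> vectors that span it, the coordinates of the noise are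
  independent standard normals (\<open>gaussian_eq_distr_std_normal\<close>), and the projection keeps \<open>d\<close> of
  them, so \<open>g \<bullet> F\<^sup>-\<^sup>1 g\<close> is chi-square with \<open>d\<close> degrees of freedom (\<open>distr_score_quadratic_form\<close>).
\<close>

section \<open>Bases orthonormal for a positive definite form\<close>

lemma inner_matrix_transpose:
  fixes A :: "real ^ 'm ^ 'n"
  shows "x \<bullet> (A *v y) = (transpose A *v x) \<bullet> y"
  by (simp add: dot_lmul_matrix)

lemma pos_def_inner_commute:
  assumes "pos_def K"
  shows "a \<bullet> (K *v b) = b \<bullet> (K *v a)"
  using assms inner_matrix_transpose[of a K b] by (simp add: pos_def_def inner_commute)

lemma pos_def_invertible:
  assumes "pos_def A"
  shows "invertible A"
proof -
  have "x = 0" if "A *v x = 0" for x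
    using assms that by (metis pos_def_def inner_zero_right less_irrefl)
  then show ?thesis
    by (metis invertible_left_inverse matrix_left_invertible_ker)
qed

lemma pos_def_matrix_inv_mult:
  assumes "pos_def A"
  shows "A ** matrix_inv A = mat 1" "matrix_inv A ** A = mat 1"
  using someI_ex[OF pos_def_invertible[OF assms, unfolded invertible_def]]
  by (simp_all add: matrix_inv_def)

lemma pos_def_matrix_inv_mult_vec:
  assumes "pos_def A"
  shows "A *v (matrix_inv A *v x) = x" "matrix_inv A *v (A *v x) = x"
  using pos_def_matrix_inv_mult[OF assms] by (simp_all add: matrix_vector_mul_assoc)

lemma pos_def_matrix_inv:
  assumes "pos_def A"
  shows "pos_def (matrix_inv A)"
  unfolding pos_def_def
proof (intro conjI allI impI)
  let ?B = "matrix_inv A"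
  note inv = pos_def_matrix_inv_mult[OF assms]
  have tA: "transpose A = A"
    using assms by (simp add: pos_def_def)
  have "transpose ?B ** A = mat 1"
    using inv(1) tA by (metis matrix_transpose_mul transpose_mat)
  then show "transpose ?B = ?B"
    using inv by (metis matrix_mul_assoc matrix_mul_lid matrix_mul_rid)
  fix v :: "real ^ 'a"
  assume "v \<noteq> 0"
  then have "?B *v v \<noteq> 0"
    using pos_def_matrix_inv_mult_vec(1)[OF assms, of v] by auto
  then have "0 < (?B *v v) \<bullet> (A *v (?B *v v))"
    using assms by (simp add: pos_def_def)
  then show "0 < v \<bullet> (?B *v v)"
    by (simp add: pos_def_matrix_inv_mult_vec[OF assms] inner_commute)
qed

lemma pos_def_scaleR:
  assumes "pos_def A" "c > 0"
  shows "pos_def (c *\<^sub>R A)"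
  using assms
  by (auto simp: pos_def_def transpose_scalar scaleR_matrix_vector_assoc[symmetric])

definition orthonormal_wrt :: "real ^ 'n ^ 'n \<Rightarrow> (real ^ 'n) set \<Rightarrow> bool" where
  "orthonormal_wrt K B \<longleftrightarrow> (\<forall>a\<in>B. \<forall>b\<in>B. a \<bullet> (K *v b) = (if a = b then 1 else 0))"

lemma orthonormal_wrt_expansion:
  assumes "orthonormal_wrt K B" "finite B" "x \<in> span B"
  shows "x = (\<Sum>b\<in>B. (b \<bullet> (K *v x)) *\<^sub>R b)"
  using assms(3)
proof (induction rule: span_induct_alt)
  case base
  then show ?case by simp
next
  case (step c x y)
  have "(\<Sum>b\<in>B. (b \<bullet> (K *v (c *\<^sub>R x + y))) *\<^sub>R b)
      = c *\<^sub>R (\<Sum>b\<in>B. (b \<bullet> (K *v x)) *\<^sub>R b) + (\<Sum>b\<in>B. (b \<bullet> (K *v y)) *\<^sub>R b)"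
    by (simp add: matrix_vector_right_distrib inner_add_right scaleR_left.add sum.distrib
        matrix_vector_mult_scaleR scaleR_sum_right)
  also have "(\<Sum>b\<in>B. (b \<bullet> (K *v x)) *\<^sub>R b) = (\<Sum>b\<in>B. if b = x then b else 0)"
    using assms(1) step(1) by (intro sum.cong) (auto simp: orthonormal_wrt_def)
  also have "\<dots> = x"
    using assms(2) step(1) by simp
  finally show ?case
    using step.IH by simp
qed

lemma orthonormal_wrt_subset:
  "orthonormal_wrt K B \<Longrightarrow> A \<subseteq> B \<Longrightarrow> orthonormal_wrt K A"
  unfolding orthonormal_wrt_def by blast

lemma orthonormal_wrt_independent:
  assumes "orthonormal_wrt K B" "finite B"
  shows "independent B"
  unfolding dependent_def
proof
  assume "\<exists>a\<in>B. a \<in> span (B - {a})"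
  then obtain a where a: "a \<in> B" "a \<in> span (B - {a})" by blast
  have "a = (\<Sum>b\<in>B - {a}. (b \<bullet> (K *v a)) *\<^sub>R b)"
    using assms a orthonormal_wrt_subset[OF assms(1), of "B - {a}"]
    by (intro orthonormal_wrt_expansion) auto
  also have "\<dots> = 0"
    using assms a by (intro sum.neutral) (auto simp: orthonormal_wrt_def)
  finally have "a \<bullet> (K *v a) = 0" by simp
  then show False
    using assms a by (simp add: orthonormal_wrt_def)
qed

text \<open>
  Gram--Schmidt for the inner product defined by \<open>K\<close>. Starting from a given orthonormal set \<open>B\<close>, rather
  than from nothing, is what allows the basis below to be adapted to a subspace.
\<close>

lemma orthonormal_wrt_extend:
  assumes K: "pos_def K" and "finite S" and B: "orthonormal_wrt K B" "finite B"
  shows "\<exists>B'. B \<subseteq> B' \<and> finite B' \<and> orthonormal_wrt K B' \<and> span B' = span (B \<union> S)"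
  using \<open>finite S\<close>
proof induction
  case empty
  then show ?case using B by auto
next
  case (insert x S)
  then obtain A where A: "B \<subseteq> A" "finite A" "orthonormal_wrt K A" "span A = span (B \<union> S)"
    by blast
  have span_xA: "span (insert x A) = span (B \<union> insert x S)"
    using span_insert[of x A] span_insert[of x "B \<union> S"] A(4) by simp
  show ?case
  proof (cases "x \<in> span A")
    case True
    then show ?thesis
      using A span_xA by (metis span_redundant)
  next
    case False
    define p where "p = (\<Sum>b\<in>A. (b \<bullet> (K *v x)) *\<^sub>R b)"
    define u where "u = (1 / sqrt ((x - p) \<bullet> (K *v (x - p)))) *\<^sub>R (x - p)"
    have p: "p \<in> span A"
      unfolding p_def by (intro span_sum span_scale span_base)
    then have "x - p \<noteq> 0"
      using False by auto
    then have pos: "(x - p) \<bullet> (K *v (x - p)) > 0"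
      using K by (auto simp: pos_def_def)
    have orth: "a \<bullet> (K *v (x - p)) = 0" if "a \<in> A" for a
    proof -
      have "a \<bullet> (K *v p) = (\<Sum>b\<in>A. (b \<bullet> (K *v x)) * (a \<bullet> (K *v b)))"
        unfolding p_def
        by (simp add: linear_sum[OF matrix_vector_mul_linear] matrix_vector_mult_scaleR inner_sum_right)
      also have "\<dots> = (\<Sum>b\<in>A. if a = b then b \<bullet> (K *v x) else 0)"
        using A(3) that by (intro sum.cong) (auto simp: orthonormal_wrt_def)
      also have "\<dots> = a \<bullet> (K *v x)"
        using A(2) that by simp
      finally show ?thesis
        by (simp add: matrix_vector_mult_diff_distrib inner_diff_right)
    qed
    have uu: "u \<bullet> (K *v u) = 1"
      using pos by (simp add: u_def matrix_vector_mult_scaleR)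
    have "a \<bullet> (K *v u) = 0" "u \<bullet> (K *v a) = 0" if "a \<in> A" for a
      using orth[OF that] pos_def_inner_commute[OF K, of u a]
      by (simp_all add: u_def matrix_vector_mult_scaleR)
    with uu A(3) have "orthonormal_wrt K (insert u A)"
      unfolding orthonormal_wrt_def by auto
    moreover have "span (insert u A) = span (insert x A)"
    proof (rule iffD2[OF span_eq], intro conjI subsetI)
      have p': "p \<in> span (insert y A)" for y
        using p span_mono[of A "insert y A"] by blast
      fix v
      { assume "v \<in> insert u A"
        moreover have "u \<in> span (insert x A)"
          unfolding u_def using p' by (intro span_scale span_diff) (auto intro: span_base)
        ultimately show "v \<in> span (insert x A)"
          by (auto intro: span_base) }
      assume "v \<in> insert x A"
      moreover have "x = sqrt ((x - p) \<bullet> (K *v (x - p))) *\<^sub>R u + p"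
        using pos by (simp add: u_def)
      then have "x \<in> span (insert u A)"
        using p' by (metis insertI1 span_add span_base span_scale)
      ultimately show "v \<in> span (insert u A)"
        by (auto intro: span_base)
    qed
    ultimately show ?thesis
      using A span_xA by (intro exI[of _ "insert u A"]) auto
  qed
qed

text \<open>
  Orthonormalizing \<open>S\<close> first and then continuing with the standard basis gives a \<open>K\<close>-orthonormal basis
  of the whole space in which the span of \<open>S\<close> is a coordinate subspace.
\<close>

lemma orthonormal_basis_adapted:
  fixes K :: "real ^ 'n ^ 'n"
  assumes K: "pos_def K" and "finite S"
  obtains w :: "'n \<Rightarrow> real ^ 'n" and I
  where "\<forall>i j. w i \<bullet> (K *v w j) = (if i = j then 1 else 0)"
    and "span (w ` I) = span S" and "card I = dim S"
proof -
  obtain B where B: "finite B" "orthonormal_wrt K B" "span B = span S"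
    using orthonormal_wrt_extend[OF K \<open>finite S\<close>, of "{}"] by (auto simp: orthonormal_wrt_def)
  obtain A where A: "B \<subseteq> A" "finite A" "orthonormal_wrt K A" "span A = span (B \<union> Basis)"
    using orthonormal_wrt_extend[OF K finite_Basis B(2,1)] by blast
  have "span A = UNIV"
    using A(4) span_mono[of Basis "B \<union> Basis"] by auto
  then have "card A = dim (UNIV :: (real ^ 'n) set)"
    using dim_eq_card[of A UNIV] orthonormal_wrt_independent[OF A(3,2)] by simp
  then have "card A = CARD('n)"
    by simp
  then obtain w :: "'n \<Rightarrow> real ^ 'n" where w: "bij_betw w UNIV A"
    using A(2) finite_same_card_bij[of "UNIV :: 'n set" A] by auto
  have inj: "w i = w j \<longleftrightarrow> i = j" for i j
    using w by (auto simp: bij_betw_def inj_on_def)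
  have wA: "w i \<in> A" for i
    using w by (auto simp: bij_betw_def)
  have im: "w ` (w -` B) = B"
    using w A(1) by (auto simp: bij_betw_def)
  have "card (w -` B) = card B"
    using inj card_image[of w "w -` B"] im by (auto simp: inj_on_def)
  also have "\<dots> = dim S"
    using orthonormal_wrt_independent[OF B(2,1)] B(3) dim_eq_card by metis
  finally show ?thesis
    using A(3) wA inj im B(3) by (intro that[of w "w -` B"]) (auto simp: orthonormal_wrt_def)
qed

lemma orthonormal_family_inj:
  assumes w: "\<And>i j. w i \<bullet> (K *v w j) = (if i = j then 1 else 0)"
  shows "inj w"
proof (rule injI)
  fix i j assume "w i = w j"
  then show "i = j"
    using w[of i i] w[of i j] by (auto split: if_splits)
qed

lemma orthonormal_family_range:
  assumes w: "\<And>i j. w i \<bullet> (K *v w j) = (if i = j then 1 else 0)"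
  shows "orthonormal_wrt K (range w)"
  using w inj_eq[OF orthonormal_family_inj[OF w]] by (auto simp: orthonormal_wrt_def)

lemma orthonormal_family_expansion:
  fixes w :: "'n::finite \<Rightarrow> real ^ 'n"
  assumes w: "\<And>i j. w i \<bullet> (K *v w j) = (if i = j then 1 else 0)"
    and x: "x \<in> span (w ` I)"
  shows "x = (\<Sum>i\<in>I. (w i \<bullet> (K *v x)) *\<^sub>R w i)"
proof -
  note ortho = orthonormal_family_inj[OF w] orthonormal_family_range[OF w]
  have "orthonormal_wrt K (w ` I)"
    by (rule orthonormal_wrt_subset[OF ortho(2)]) auto
  then have "x = (\<Sum>b\<in>w ` I. (b \<bullet> (K *v x)) *\<^sub>R b)"
    using x by (intro orthonormal_wrt_expansion) auto
  also have "\<dots> = (\<Sum>i\<in>I. (w i \<bullet> (K *v x)) *\<^sub>R w i)"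
    using ortho(1) by (simp add: sum.reindex inj_on_subset)
  finally show ?thesis .
qed

lemma orthonormal_family_span:
  fixes w :: "'n::finite \<Rightarrow> real ^ 'n"
  assumes w: "\<And>i j. w i \<bullet> (K *v w j) = (if i = j then 1 else 0)"
  shows "span (range w) = UNIV"
proof -
  have "card (range w) = CARD('n)"
    using orthonormal_family_inj[OF w] by (rule card_image)
  then show ?thesis
    using orthonormal_wrt_independent[OF orthonormal_family_range[OF w]]
    by (metis dim_UNIV card_ge_dim_independent DIM_cart DIM_real mult.right_neutral
      finite_imageI finite_code order_refl subset_UNIV top.extremum_uniqueI)
qed

section \<open>Gaussian vectors as images of independent standard normals\<close>

text \<open>
  An invertible linear map scales Lebesgue measure by a constant, here read off from a single even
  probability density \<open>b\<close>. This is the uniqueness argument for Haar measure: insert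
  \<open>\<integral> b (y - T x) dy = 1\<close>, exchange the integrals, translate \<open>x\<close> by \<open>T\<^sup>-\<^sup>1 y\<close>, and exchange back.
  Choosing for \<open>b\<close> the Gaussian density itself replaces the computation of the Jacobian determinant
  by the normalization of that density.
\<close>

lemma nn_integral_lborel_linear:
  fixes T T' :: "'a::euclidean_space \<Rightarrow> 'a" and f b :: "'a \<Rightarrow> ennreal"
  assumes T: "linear T" "\<And>x. T (T' x) = x"
    and [measurable]: "f \<in> borel_measurable borel" "b \<in> borel_measurable borel"
    and b: "(\<integral>\<^sup>+ x. b x \<partial>lborel) = 1" "\<And>x. b (- x) = b x"
  shows "(\<integral>\<^sup>+ x. f (T x) \<partial>lborel) = (\<integral>\<^sup>+ x. b (T x) \<partial>lborel) * (\<integral>\<^sup>+ x. f x \<partial>lborel)"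
proof -
  have [measurable]: "T \<in> borel_measurable borel"
    using T(1) by (intro borel_measurable_continuous_onI linear_continuous_on linear_conv_bounded_linear[THEN iffD1])
  have shift: "(\<integral>\<^sup>+ x. g (c + x) \<partial>lborel) = (\<integral>\<^sup>+ x. g x \<partial>lborel)"
    if [measurable]: "g \<in> borel_measurable borel" for g :: "'a \<Rightarrow> ennreal" and c
    by (subst (2) lborel_distr_plus[of c, symmetric], subst nn_integral_distr) auto
  have "(\<integral>\<^sup>+ x. f (T x) \<partial>lborel) = (\<integral>\<^sup>+ x. f (T x) * (\<integral>\<^sup>+ y. b (- T x + y) \<partial>lborel) \<partial>lborel)"
    by (subst shift) (auto simp: b)
  also have "\<dots> = (\<integral>\<^sup>+ x. \<integral>\<^sup>+ y. f (T x) * b (- T x + y) \<partial>lborel \<partial>lborel)"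
    by (intro nn_integral_cong nn_integral_cmult[symmetric]) measurable
  also have "\<dots> = (\<integral>\<^sup>+ y. \<integral>\<^sup>+ x. f (T x) * b (- T x + y) \<partial>lborel \<partial>lborel)"
    by (intro lborel_pair.Fubini'[symmetric]) measurable
  \<comment> \<open>The translation moves \<open>y\<close> from the argument of \<open>b\<close> to that of \<open>f\<close>.\<close>
  also have "\<dots> = (\<integral>\<^sup>+ y. \<integral>\<^sup>+ x. f (T (T' y + x)) * b (- T (T' y + x) + y) \<partial>lborel \<partial>lborel)"
    by (intro nn_integral_cong shift[symmetric, where g = "\<lambda>x. f (T x) * b (- T x + _)"]) measurable
  also have "\<dots> = (\<integral>\<^sup>+ y. \<integral>\<^sup>+ x. b (T x) * f (T x + y) \<partial>lborel \<partial>lborel)"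
    by (simp add: linear_add[OF T(1)] T(2) b(2) mult.commute add.commute)
  also have "\<dots> = (\<integral>\<^sup>+ x. \<integral>\<^sup>+ y. b (T x) * f (T x + y) \<partial>lborel \<partial>lborel)"
    by (intro lborel_pair.Fubini') measurable
  also have "\<dots> = (\<integral>\<^sup>+ x. b (T x) * (\<integral>\<^sup>+ y. f (T x + y) \<partial>lborel) \<partial>lborel)"
    by (intro nn_integral_cong nn_integral_cmult) measurable
  also have "\<dots> = (\<integral>\<^sup>+ x. b (T x) \<partial>lborel) * (\<integral>\<^sup>+ x. f x \<partial>lborel)"
    by (subst shift) (auto simp: nn_integral_multc)
  finally show ?thesis .
qed

lemma measurable_vec_lambda[measurable]:
  "vec_lambda \<in> measurable (PiM UNIV (\<lambda>_::'n::finite. lborel :: real measure)) borel"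
  by (subst borel_measurable_euclidean_space) (auto simp: Basis_vec_def inner_axis)

text \<open>
  Product over the index type instead of over the basis vectors, to match products of standard normals
  indexed by coordinates.
\<close>

lemma lborel_eq_distr_PiM_vec:
  "(lborel :: (real ^ 'n) measure) = distr (PiM UNIV (\<lambda>_. lborel)) borel vec_lambda"
proof (rule lborel_eqI)
  interpret product_sigma_finite "\<lambda>_::'n. lborel :: real measure" ..
  fix l u :: "real ^ 'n"
  assume box: "\<And>b. b \<in> Basis \<Longrightarrow> l \<bullet> b \<le> u \<bullet> b"
  have le: "l $ i \<le> u $ i" for i
  proof -
    have "axis i 1 \<in> (Basis :: (real ^ 'n) set)"
      by (auto simp: Basis_vec_def)
    with box[of "axis i 1"] show ?thesis
      by (simp add: inner_axis)
  qed
  have "emeasure (distr (PiM UNIV (\<lambda>_. lborel)) borel vec_lambda) (box l u)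
      = emeasure (PiM UNIV (\<lambda>_::'n. lborel)) (PiE UNIV (\<lambda>i. {l $ i<..<u $ i}))"
    by (subst emeasure_distr)
       (auto intro!: arg_cong2[of _ _ _ _ emeasure] simp: space_PiM mem_box_cart PiE_def Pi_def)
  also have "\<dots> = (\<Prod>i\<in>UNIV. ennreal (u $ i - l $ i))"
    using le by (subst emeasure_PiM) auto
  also have "\<dots> = ennreal (\<Prod>i\<in>UNIV. u $ i - l $ i)"
    using le by (intro prod_ennreal) auto
  also have "(\<Prod>i\<in>UNIV. u $ i - l $ i) = (\<Prod>b\<in>Basis. (u - l) \<bullet> b)"
    unfolding Basis_vec_def
    by (simp add: UNION_singleton_eq_range prod.reindex inj_on_def axis_eq_axis inner_axis)
  finally show "emeasure (distr (PiM UNIV (\<lambda>_. lborel)) borel vec_lambda) (box l u)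
      = ennreal (\<Prod>b\<in>Basis. (u - l) \<bullet> b)" .
qed simp

lemma PiM_density_prod:
  fixes M :: "'i \<Rightarrow> 'a measure"
  assumes I: "finite I" and "\<And>i. sigma_finite_measure (M i)"
    and "\<And>i. sigma_finite_measure (density (M i) (f i))"
    and f[measurable]: "\<And>i. f i \<in> borel_measurable (M i)"
  shows "density (PiM I M) (\<lambda>x. \<Prod>i\<in>I. f i (x i)) = PiM I (\<lambda>i. density (M i) (f i))"
proof -
  interpret M: product_sigma_finite M
    using assms by (simp add: product_sigma_finite_def)
  interpret D: product_sigma_finite "\<lambda>i. density (M i) (f i)"
    using assms by (simp add: product_sigma_finite_def)
  show ?thesis
  proof (rule D.PiM_eqI[OF I])
    show "sets (density (PiM I M) (\<lambda>x. \<Prod>i\<in>I. f i (x i))) = sets (PiM I (\<lambda>i. density (M i) (f i)))"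
      by (simp cong: sets_PiM_cong)
    fix A assume "\<And>i. i \<in> I \<Longrightarrow> A i \<in> sets (density (M i) (f i))"
    then have A[measurable]: "\<And>i. i \<in> I \<Longrightarrow> A i \<in> sets (M i)" by simp
    have [measurable]: "Pi\<^sub>E I A \<in> sets (PiM I M)"
      using I A by (intro sets_PiM_I_finite) auto
    have "emeasure (density (PiM I M) (\<lambda>x. \<Prod>i\<in>I. f i (x i))) (Pi\<^sub>E I A)
        = (\<integral>\<^sup>+ x. (\<Prod>i\<in>I. f i (x i)) * indicator (Pi\<^sub>E I A) x \<partial>PiM I M)"
      by (intro emeasure_density) measurable
    also have "\<dots> = (\<integral>\<^sup>+ x. (\<Prod>i\<in>I. f i (x i) * indicator (A i) (x i)) \<partial>PiM I M)"
    proof (intro nn_integral_cong)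
      fix x assume x: "x \<in> space (PiM I M)"
      have "indicator (Pi\<^sub>E I A) x = (\<Prod>i\<in>I. indicator (A i) (x i) :: ennreal)"
        using x I by (auto simp: indicator_def space_PiM PiE_iff prod_zero_iff)
      then show "(\<Prod>i\<in>I. f i (x i)) * indicator (Pi\<^sub>E I A) x = (\<Prod>i\<in>I. f i (x i) * indicator (A i) (x i))"
        by (simp add: prod.distrib)
    qed
    also have "\<dots> = (\<Prod>i\<in>I. \<integral>\<^sup>+ x. f i x * indicator (A i) x \<partial>M i)"
      using I A by (intro M.product_nn_integral_prod) auto
    also have "\<dots> = (\<Prod>i\<in>I. emeasure (density (M i) (f i)) (A i))"
      using A by (intro prod.cong refl emeasure_density[symmetric]) auto
    finally show "emeasure (density (PiM I M) (\<lambda>x. \<Prod>i\<in>I. f i (x i))) (Pi\<^sub>E I A)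
        = (\<Prod>i\<in>I. emeasure (density (M i) (f i)) (A i))" .
  qed
qed

abbreviation std_normal :: "real measure" where
  "std_normal \<equiv> density lborel (\<lambda>x. ennreal (std_normal_density x))"

lemma prob_space_std_normal: "prob_space std_normal"
  by (rule prob_space_normal_density) simp

text \<open>
  A nonpositive normalizing constant would make the density nonpositive everywhere (division by zero
  gives zero), and the measure would vanish.
\<close>

lemma gaussian_normalization_pos:
  assumes "prob_space (gaussian \<mu> C)"
  shows "sqrt ((2 * pi) ^ CARD('n) * det (C :: real ^ 'n ^ 'n)) > 0"
proof (rule ccontr)
  assume "\<not> ?thesis"
  then have "gaussian_density \<mu> C v \<le> 0" for v
    unfolding gaussian_density_def by (intro divide_nonneg_nonpos) auto
  then have "emeasure (gaussian \<mu> C) UNIV = 0"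
    by (simp add: gaussian_def emeasure_density ennreal_neg)
  with prob_space.emeasure_space_1[OF assms] show False
    by (simp add: gaussian_def)
qed

lemma borel_measurable_matrix_vector_mult[measurable]:
  fixes A :: "real ^ 'n ^ 'm"
  shows "(\<lambda>v. A *v v) \<in> borel_measurable borel"
  by (intro borel_measurable_continuous_onI linear_continuous_on linear_conv_bounded_linear[THEN iffD1])
     (rule matrix_vector_mul_linear)

lemma borel_measurable_gaussian_density[measurable]:
  "gaussian_density \<mu> C \<in> borel_measurable borel"
proof -
  have "gaussian_density \<mu> C = (\<lambda>v. exp (- ((v - \<mu>) \<bullet> (matrix_inv C *v (v - \<mu>))) / 2)
      / sqrt ((2 * pi) ^ CARD('a) * det C))"
    by (simp add: fun_eq_iff gaussian_density_def)
  also have "\<dots> \<in> borel_measurable borel" by measurable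
  finally show ?thesis .
qed

text \<open>
  Whitening: the coordinates of a centred Gaussian vector with respect to a basis orthonormal for the
  inverse covariance are independent standard normals, because in these coordinates the exponent of
  the density is a sum of squares.
\<close>

lemma gaussian_eq_distr_std_normal:
  fixes C :: "real ^ 'n ^ 'n" and w :: "'n \<Rightarrow> real ^ 'n"
  assumes prob: "prob_space (gaussian 0 C)"
    and w: "\<And>i j. w i \<bullet> (matrix_inv C *v w j) = (if i = j then 1 else 0)"
  shows "gaussian 0 C = distr (PiM UNIV (\<lambda>_. std_normal)) borel (\<lambda>z. \<Sum>i\<in>UNIV. z i *\<^sub>R w i)"
proof -
  define T :: "real ^ 'n \<Rightarrow> real ^ 'n" where "T z = (\<Sum>i\<in>UNIV. z $ i *\<^sub>R w i)" for z
  define T' :: "real ^ 'n \<Rightarrow> real ^ 'n" where "T' v = (\<chi> i. w i \<bullet> (matrix_inv C *v v))" for v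
  let ?b = "\<lambda>v. ennreal (gaussian_density 0 C v)"
  have T: "linear T"
    unfolding T_def
    by (intro linearI) (simp_all add: scaleR_left.add sum.distrib scaleR_sum_right)
  have T': "T (T' v) = v" for v
    using orthonormal_family_expansion[where w = w and K = "matrix_inv C" and I = UNIV and x = v] w
      orthonormal_family_span[where w = w and K = "matrix_inv C"]
    by (simp add: T_def T'_def)
  have [measurable]: "T \<in> borel_measurable borel"
    using T by (intro borel_measurable_continuous_onI linear_continuous_on linear_conv_bounded_linear[THEN iffD1])
  \<comment> \<open>The ratio of the two normalizing constants. It is also the factor by which \<open>T\<close> scales Lebesgue
     measure, as both densities have total mass one, and so it cancels in the end.\<close>
  define c where "c = sqrt (2 * pi) ^ CARD('n) / sqrt ((2 * pi) ^ CARD('n) * det C)"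
  have c: "c > 0"
    using gaussian_normalization_pos[OF prob] by (simp add: c_def)
  have bT: "gaussian_density 0 C (T z) = c * (\<Prod>i\<in>UNIV. std_normal_density (z $ i))" for z
  proof -
    have "T z \<bullet> (matrix_inv C *v T z) = (\<Sum>i\<in>UNIV. \<Sum>j\<in>UNIV. z $ i * (z $ j * (w j \<bullet> (matrix_inv C *v w i))))"
      by (simp add: T_def linear_sum[OF matrix_vector_mul_linear] matrix_vector_mult_scaleR
          inner_sum_left inner_sum_right sum_distrib_left)
    also have "\<dots> = (\<Sum>i\<in>UNIV. (z $ i)\<^sup>2)"
      by (simp add: w power2_eq_square if_distrib cong: if_cong)
    finally show ?thesis
      by (simp add: gaussian_density_def c_def std_normal_density_def prod_dividef exp_sum[symmetric]
          sum_negf sum_divide_distrib[symmetric] prod.distrib)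
  qed
  let ?P = "PiM UNIV (\<lambda>_::'n. lborel :: real measure)"
  have std: "PiM UNIV (\<lambda>_::'n. std_normal) = density ?P (\<lambda>z. \<Prod>i\<in>UNIV. ennreal (std_normal_density (z i)))"
    by (rule PiM_density_prod[symmetric])
       (auto intro: prob_space_imp_sigma_finite prob_space_std_normal sigma_finite_lborel)
  have nnT: "(\<integral>\<^sup>+ z. ennreal (\<Prod>i\<in>UNIV. std_normal_density (z $ i)) * g (T z) \<partial>lborel)
      = (\<integral>\<^sup>+ z. g (\<Sum>i\<in>UNIV. z i *\<^sub>R w i) \<partial>PiM UNIV (\<lambda>_. std_normal))"
    if [measurable]: "g \<in> borel_measurable borel" for g :: "real ^ 'n \<Rightarrow> ennreal"
  proof -
    have "(\<integral>\<^sup>+ z. ennreal (\<Prod>i\<in>UNIV. std_normal_density (z $ i)) * g (T z) \<partial>lborel)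
        = (\<integral>\<^sup>+ z. ennreal (\<Prod>i\<in>UNIV. std_normal_density (vec_lambda z $ i)) * g (T (vec_lambda z)) \<partial>?P)"
      by (subst lborel_eq_distr_PiM_vec, subst nn_integral_distr) auto
    also have "\<dots> = (\<integral>\<^sup>+ z. g (T (vec_lambda z)) \<partial>PiM UNIV (\<lambda>_. std_normal))"
      unfolding std by (subst nn_integral_density) (auto simp: prod_ennreal)
    finally show ?thesis
      by (simp add: T_def)
  qed
  interpret N: prob_space "PiM UNIV (\<lambda>_::'n. std_normal)"
    by (intro prob_space_PiM prob_space_std_normal)
  have b1: "(\<integral>\<^sup>+ v. ?b v \<partial>lborel) = 1"
    using prob_space.emeasure_space_1[OF prob] by (simp add: gaussian_def emeasure_density)
  have "(\<integral>\<^sup>+ z. ?b (T z) \<partial>lborel) = ennreal c * (\<integral>\<^sup>+ z. ennreal (\<Prod>i\<in>UNIV. std_normal_density ((z :: real ^ 'n) $ i)) * 1 \<partial>lborel)"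
    using c by (subst nn_integral_cmult[symmetric]) (auto simp: bT ennreal_mult' prod_nonneg)
  also have "\<dots> = ennreal c"
    by (subst nnT) (auto simp: N.emeasure_space_1)
  finally have scale: "(\<integral>\<^sup>+ z. f (T z) \<partial>lborel) = ennreal c * (\<integral>\<^sup>+ v. f v \<partial>lborel)"
    if "f \<in> borel_measurable borel" for f :: "real ^ 'n \<Rightarrow> ennreal"
    using nn_integral_lborel_linear[OF T T' that _ b1]
    by (simp add: gaussian_density_def linear_neg[OF matrix_vector_mul_linear])
  have meas: "(\<lambda>z. \<Sum>i\<in>UNIV. z i *\<^sub>R w i) \<in> borel_measurable (PiM UNIV (\<lambda>_. std_normal))"
    by measurable
  show ?thesis
  proof (rule measure_eqI)
    show "sets (gaussian 0 C) = sets (distr (PiM UNIV (\<lambda>_. std_normal)) borel (\<lambda>z. \<Sum>i\<in>UNIV. z i *\<^sub>R w i))"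
      by (simp add: gaussian_def)
    fix A assume "A \<in> sets (gaussian 0 C)"
    then have [measurable]: "A \<in> sets borel"
      by (simp add: gaussian_def)
    have "ennreal c * emeasure (gaussian 0 C) A = ennreal c * (\<integral>\<^sup>+ v. ?b v * indicator A v \<partial>lborel)"
      by (simp add: gaussian_def emeasure_density)
    also have "\<dots> = (\<integral>\<^sup>+ z. ?b (T z) * indicator A (T z) \<partial>lborel)"
      by (subst scale) auto
    also have "\<dots> = (\<integral>\<^sup>+ z. ennreal c * (ennreal (\<Prod>i\<in>UNIV. std_normal_density (z $ i)) * indicator A (T z)) \<partial>lborel)"
      using c by (simp add: bT ennreal_mult' prod_nonneg mult.assoc)
    also have "\<dots> = ennreal c * (\<integral>\<^sup>+ z. ennreal (\<Prod>i\<in>UNIV. std_normal_density (z $ i)) * indicator A (T z) \<partial>lborel)"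
      by (intro nn_integral_cmult) measurable
    also have "\<dots> = ennreal c * (\<integral>\<^sup>+ z. indicator A (\<Sum>i\<in>UNIV. z i *\<^sub>R w i) \<partial>PiM UNIV (\<lambda>_. std_normal))"
      by (subst nnT) auto
    also have "\<dots> = ennreal c * emeasure (distr (PiM UNIV (\<lambda>_. std_normal)) borel (\<lambda>z. \<Sum>i\<in>UNIV. z i *\<^sub>R w i)) A"
      by (subst nn_integral_distr[symmetric, where f = "indicator A", OF meas]) auto
    finally show "emeasure (gaussian 0 C) A
        = emeasure (distr (PiM UNIV (\<lambda>_. std_normal)) borel (\<lambda>z. \<Sum>i\<in>UNIV. z i *\<^sub>R w i)) A"
      using c by (simp add: ennreal_mult_cancel_left)
  qed
qed

section \<open>Moments and the chi-square distribution\<close>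

lemma std_normal_moments:
  shows "has_bochner_integral std_normal (\<lambda>x. x) 0"
    and "has_bochner_integral std_normal (\<lambda>x. x\<^sup>2) 1"
    and "has_bochner_integral std_normal (\<lambda>x. x ^ 4) 3"
proof -
  have *: "has_bochner_integral std_normal f c"
    if "has_bochner_integral lborel (\<lambda>x. std_normal_density x * f x) c"
      and "f \<in> borel_measurable borel" for f c
    using that by (intro has_bochner_integral_density) auto
  show "has_bochner_integral std_normal (\<lambda>x. x) 0"
    using std_normal_moment_odd[of 0] by (intro *) auto
  show "has_bochner_integral std_normal (\<lambda>x. x\<^sup>2) 1"
    using std_normal_moment_even[of 1] by (intro *) (auto simp: fact_numeral)
  show "has_bochner_integral std_normal (\<lambda>x. x ^ 4) 3"
    using std_normal_moment_even[of 2] by (intro *) (auto simp: fact_numeral)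
qed

lemma PiM_std_normal_component:
  assumes "i \<in> I" "has_bochner_integral std_normal f c"
  shows "has_bochner_integral (PiM I (\<lambda>_. std_normal)) (\<lambda>z. f (z i) :: real) c"
proof -
  have f: "f \<in> borel_measurable std_normal"
    using assms(2) by (rule borel_measurable_has_bochner_integral)
  have g: "(\<lambda>z. z i) \<in> measurable (PiM I (\<lambda>_. std_normal)) std_normal"
    using assms(1) by (rule measurable_component_singleton)
  have "has_bochner_integral (distr (PiM I (\<lambda>_. std_normal)) std_normal (\<lambda>z. z i)) f c"
    using assms distr_PiM_component[of I "\<lambda>_. std_normal" i] prob_space_std_normal by simp
  then show ?thesis
    using integrable_distr_eq[OF g f] integral_distr[OF g f] by (simp add: has_bochner_integral_iff)
qed

text \<open>
  The product over all indices of \<open>f\<close> at \<open>i\<close>, \<open>g\<close> at \<open>j\<close> and \<open>1\<close> elsewhere reduces the claim to the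
  product formula for integrals.
\<close>

lemma PiM_std_normal_two_components:
  assumes I: "finite I" "i \<in> I" "j \<in> I" "i \<noteq> j"
    and f: "has_bochner_integral std_normal f c" and g: "has_bochner_integral std_normal g d"
  shows "has_bochner_integral (PiM I (\<lambda>_. std_normal)) (\<lambda>z. f (z i) * g (z j) :: real) (c * d)"
proof -
  interpret N: prob_space std_normal
    by (rule prob_space_std_normal)
  interpret product_sigma_finite "\<lambda>_. std_normal" ..
  define h where "h l x = (if l = i then f x else 1) * (if l = j then g x else 1)" for l x
  have h: "has_bochner_integral std_normal (h l) ((if l = i then c else 1) * (if l = j then d else 1))" for l
    using f g I(4) N.prob_space
    by (cases "l = i"; cases "l = j") (auto simp: h_def[abs_def] has_bochner_integral_iff)
  have eq: "(\<Prod>l\<in>I. h l (z l)) = f (z i) * g (z j)" for z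
    using I by (simp add: h_def prod.distrib)
  have int: "integrable std_normal (h l)" for l
    using h[of l] by (simp add: has_bochner_integral_iff)
  have "integrable (PiM I (\<lambda>_. std_normal)) (\<lambda>z. f (z i) * g (z j))"
    using product_integrable_prod[where f = h, OF I(1)] int by (simp add: eq)
  moreover have "(\<integral>z. f (z i) * g (z j) \<partial>PiM I (\<lambda>_. std_normal)) = c * d"
    using product_integral_prod[where f = h, OF I(1)] int I
    by (simp add: eq has_bochner_integral_integral_eq[OF h] prod.distrib)
  ultimately show ?thesis
    by (simp add: has_bochner_integral_iff)
qed

lemma PiM_std_normal_covariance:
  assumes "finite I" "i \<in> I" "j \<in> I"
  shows "has_bochner_integral (PiM I (\<lambda>_. std_normal)) (\<lambda>z. z i * z j) (if i = j then 1 else 0)"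
  using PiM_std_normal_component[OF assms(2) std_normal_moments(2)]
    PiM_std_normal_two_components[OF assms _ std_normal_moments(1) std_normal_moments(1)]
  by (auto simp: power2_eq_square)

text \<open>
  In the second moment, the diagonal terms are fourth moments of a standard normal, equal to \<open>3\<close>, and the
  off-diagonal ones are \<open>1\<close>. This gives the variance \<open>2 k\<close>.
\<close>

lemma chi_square_moments:
  shows "has_bochner_integral (chi_square k) (\<lambda>x. x) (real k)"
    and "has_bochner_integral (chi_square k) (\<lambda>x. x\<^sup>2) ((real k)\<^sup>2 + 2 * real k)"
proof -
  let ?P = "PiM {..<k} (\<lambda>_. std_normal)"
  have meas: "(\<lambda>z. \<Sum>i<k. (z i)\<^sup>2) \<in> borel_measurable ?P"
    by measurable
  have "has_bochner_integral ?P (\<lambda>z. \<Sum>i<k. (z i)\<^sup>2) (\<Sum>i<k. 1)"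
    by (intro has_bochner_integral_sum PiM_std_normal_component std_normal_moments) auto
  then show "has_bochner_integral (chi_square k) (\<lambda>x. x) (real k)"
    unfolding chi_square_def by (intro has_bochner_integral_distr meas) auto
  have "has_bochner_integral ?P (\<lambda>z. (z i)\<^sup>2 * (z j)\<^sup>2) (1 + (if i = j then 2 else 0))"
    if "i < k" "j < k" for i j
    using PiM_std_normal_component[OF _ std_normal_moments(3), of i "{..<k}"]
      PiM_std_normal_two_components[OF _ _ _ _ std_normal_moments(2,2), of "{..<k}" i j] that
    by (auto simp: power_add[symmetric])
  then have "has_bochner_integral ?P (\<lambda>z. \<Sum>i<k. \<Sum>j<k. (z i)\<^sup>2 * (z j)\<^sup>2)
      (\<Sum>i<k. \<Sum>j<k. 1 + (if i = j then 2 else 0))"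
    by (intro has_bochner_integral_sum) auto
  also have "(\<Sum>i<k. \<Sum>j<k. 1 + (if i = j then 2 else 0)) = (real k)\<^sup>2 + 2 * real k"
    by (simp add: sum.distrib power2_eq_square algebra_simps)
  also have "(\<lambda>z :: nat \<Rightarrow> real. \<Sum>i<k. \<Sum>j<k. (z i)\<^sup>2 * (z j)\<^sup>2) = (\<lambda>z. (\<Sum>i<k. (z i)\<^sup>2)\<^sup>2)"
    by (simp add: power2_eq_square sum_product)
  finally show "has_bochner_integral (chi_square k) (\<lambda>x. x\<^sup>2) ((real k)\<^sup>2 + 2 * real k)"
    unfolding chi_square_def by (intro has_bochner_integral_distr meas) auto
qed

text \<open>
  Enumerating \<open>J\<close> by an injection and dropping the other coordinates maps the product of identical
  probability measures to the product over the first \<open>card J\<close> naturals.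
\<close>

lemma distr_sum_squares_std_normal:
  assumes "finite I" "J \<subseteq> I"
  shows "distr (PiM I (\<lambda>_. std_normal)) borel (\<lambda>z. \<Sum>i\<in>J. (z i)\<^sup>2) = chi_square (card J)"
proof -
  let ?n = "{..<card J}"
  obtain f where f: "bij_betw f ?n J"
    using finite_subset[OF assms(2,1)] by (metis bij_betw_from_nat_into_finite lessThan_atLeast0 ex_bij_betw_nat_finite)
  have fI: "inj_on f ?n" "f \<in> ?n \<rightarrow> I"
    using f assms(2) by (auto simp: bij_betw_def)
  let ?r = "\<lambda>z. \<lambda>n\<in>?n. z (f n)"
  have r: "?r \<in> measurable (PiM I (\<lambda>_. std_normal)) (PiM ?n (\<lambda>_. std_normal))"
    using fI by (intro measurable_restrict measurable_component_singleton) auto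
  have "chi_square (card J) = distr (distr (PiM I (\<lambda>_. std_normal)) (PiM ?n (\<lambda>_. std_normal)) ?r) borel
      (\<lambda>z. \<Sum>i<card J. (z i)\<^sup>2)"
    unfolding chi_square_def
    using distr_PiM_reindex[where M = "\<lambda>_. std_normal", OF _ fI] prob_space_std_normal by simp
  also have "\<dots> = distr (PiM I (\<lambda>_. std_normal)) borel ((\<lambda>z. \<Sum>i<card J. (z i)\<^sup>2) \<circ> ?r)"
    by (intro distr_distr r) measurable
  also have "(\<lambda>z. \<Sum>i<card J. (z i)\<^sup>2) \<circ> ?r = (\<lambda>z. \<Sum>i\<in>J. (z i)\<^sup>2)"
  proof (rule ext)
    fix z
    show "((\<lambda>z. \<Sum>i<card J. (z i)\<^sup>2) \<circ> ?r) z = (\<Sum>i\<in>J. (z i)\<^sup>2)"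
      using sum.reindex_bij_betw[OF f, of "\<lambda>i. (z i)\<^sup>2"] by simp
  qed
  finally show ?thesis ..
qed

lemma measurable_linear_combination:
  fixes w :: "'i \<Rightarrow> 'a::euclidean_space"
  shows "(\<lambda>z. \<Sum>i\<in>I. z i *\<^sub>R w i) \<in> borel_measurable (PiM I (\<lambda>_. std_normal))"
  by measurable

text \<open>
  In whitened coordinates the covariance becomes \<open>\<Sum>\<^sub>i (a \<bullet> w\<^sub>i) (b \<bullet> w\<^sub>i)\<close>, and
  \<open>\<Sum>\<^sub>i (w\<^sub>i \<bullet> b) w\<^sub>i\<close> is the expansion of \<open>C b\<close> in the basis \<open>w\<close>.
\<close>

lemma gaussian_moments:
  fixes C :: "real ^ 'n ^ 'n"
  assumes C: "pos_def C" and prob: "prob_space (gaussian 0 C)"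
  shows "has_bochner_integral (gaussian 0 C) (\<lambda>v. a \<bullet> v) 0"
    and "has_bochner_integral (gaussian 0 C) (\<lambda>v. (a \<bullet> v) * (b \<bullet> v)) (a \<bullet> (C *v b))"
proof -
  obtain w :: "'n \<Rightarrow> real ^ 'n" and I where
    "\<forall>i j. w i \<bullet> (matrix_inv C *v w j) = (if i = j then 1 else 0)"
    by (rule orthonormal_basis_adapted[OF pos_def_matrix_inv[OF C] finite.emptyI])
  then have w: "w i \<bullet> (matrix_inv C *v w j) = (if i = j then 1 else 0)" for i j
    by blast
  note G = gaussian_eq_distr_std_normal[OF prob w]
  let ?P = "PiM UNIV (\<lambda>_::'n. std_normal)"
  have "has_bochner_integral ?P (\<lambda>z. \<Sum>i\<in>UNIV. z i * (a \<bullet> w i)) (\<Sum>i\<in>UNIV. 0 * (a \<bullet> w i))"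
    by (intro has_bochner_integral_sum has_bochner_integral_mult_left PiM_std_normal_component
        std_normal_moments) auto
  then show "has_bochner_integral (gaussian 0 C) (\<lambda>v. a \<bullet> v) 0"
    unfolding G
    by (intro has_bochner_integral_distr measurable_linear_combination)
       (auto simp: inner_sum_right)
  have "has_bochner_integral ?P (\<lambda>z. \<Sum>i\<in>UNIV. \<Sum>j\<in>UNIV. z i * z j * ((a \<bullet> w i) * (b \<bullet> w j)))
     (\<Sum>i\<in>UNIV. \<Sum>j\<in>UNIV. (if i = j then 1 else 0) * ((a \<bullet> w i) * (b \<bullet> w j)))"
    by (intro has_bochner_integral_sum has_bochner_integral_mult_left PiM_std_normal_covariance) auto
  also have "(\<lambda>z. \<Sum>i\<in>UNIV. \<Sum>j\<in>UNIV. z i * z j * ((a \<bullet> w i) * (b \<bullet> w j)))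
      = (\<lambda>z. (a \<bullet> (\<Sum>i\<in>UNIV. z i *\<^sub>R w i)) * (b \<bullet> (\<Sum>i\<in>UNIV. z i *\<^sub>R w i)))"
    by (simp add: inner_sum_right sum_product mult_ac)
  also have "(\<Sum>i\<in>UNIV. \<Sum>j\<in>UNIV. (if i = j then 1 else 0) * ((a \<bullet> w i) * (b \<bullet> w j)))
      = (\<Sum>i\<in>UNIV. (a \<bullet> w i) * (b \<bullet> w i))"
    by (simp add: if_distrib[of "\<lambda>x. x * _"] cong: if_cong)
  also have "\<dots> = a \<bullet> (\<Sum>i\<in>UNIV. (w i \<bullet> (matrix_inv C *v (C *v b))) *\<^sub>R w i)"
    by (simp add: pos_def_matrix_inv_mult_vec[OF C] inner_sum_right inner_commute mult_ac)
  also have "(\<Sum>i\<in>UNIV. (w i \<bullet> (matrix_inv C *v (C *v b))) *\<^sub>R w i) = C *v b"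
    using orthonormal_family_expansion[where w = w and K = "matrix_inv C" and I = UNIV and x = "C *v b"]
      orthonormal_family_span[where w = w and K = "matrix_inv C"] w by simp
  finally show "has_bochner_integral (gaussian 0 C) (\<lambda>v. (a \<bullet> v) * (b \<bullet> v)) (a \<bullet> (C *v b))"
    unfolding G
    by (intro has_bochner_integral_distr measurable_linear_combination) auto
qed

text \<open>
  With \<open>K = C\<^sup>-\<^sup>1\<close>, these are moments of the vector \<open>K v\<close>, whose covariance is \<open>K C K = K\<close>.
\<close>

lemma gaussian_inverse_moments:
  fixes C :: "real ^ 'n ^ 'n"
  assumes C: "pos_def C" and prob: "prob_space (gaussian 0 C)"
  shows "has_bochner_integral (gaussian 0 C) (\<lambda>v. a \<bullet> (matrix_inv C *v v)) 0"
    and "has_bochner_integral (gaussian 0 C)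
      (\<lambda>v. (a \<bullet> (matrix_inv C *v v)) * (b \<bullet> (matrix_inv C *v v))) (a \<bullet> (matrix_inv C *v b))"
proof -
  note K = pos_def_inner_commute[OF pos_def_matrix_inv[OF C]]
  have "x \<bullet> (matrix_inv C *v v) = (matrix_inv C *v x) \<bullet> v" for x v
    using K[of x v] by (simp add: inner_commute)
  then show "has_bochner_integral (gaussian 0 C) (\<lambda>v. a \<bullet> (matrix_inv C *v v)) 0"
    and "has_bochner_integral (gaussian 0 C)
      (\<lambda>v. (a \<bullet> (matrix_inv C *v v)) * (b \<bullet> (matrix_inv C *v v))) (a \<bullet> (matrix_inv C *v b))"
    using gaussian_moments(1)[OF C prob, of "matrix_inv C *v a"]
      gaussian_moments(2)[OF C prob, of "matrix_inv C *v a" "matrix_inv C *v b"]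
    by (simp_all add: pos_def_matrix_inv_mult_vec[OF C] K[of b a] inner_commute)
qed

lemma gaussian_translate:
  fixes C :: "real ^ 'n ^ 'n"
  shows "gaussian \<mu> C = distr (gaussian 0 C) borel (\<lambda>v. \<mu> + v)"
proof (rule measure_eqI)
  show "sets (gaussian \<mu> C) = sets (distr (gaussian 0 C) borel (\<lambda>v. \<mu> + v))"
    by (simp add: gaussian_def)
  fix A assume "A \<in> sets (gaussian \<mu> C)"
  then have [measurable]: "A \<in> sets borel"
    by (simp add: gaussian_def)
  have "emeasure (gaussian \<mu> C) A = (\<integral>\<^sup>+ v. ennreal (gaussian_density \<mu> C v) * indicator A v \<partial>lborel)"
    by (simp add: gaussian_def emeasure_density)
  also have "\<dots> = (\<integral>\<^sup>+ v. ennreal (gaussian_density \<mu> C (\<mu> + v)) * indicator A (\<mu> + v) \<partial>lborel)"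
    by (subst lborel_distr_plus[of \<mu>, symmetric], subst nn_integral_distr) auto
  also have "\<dots> = (\<integral>\<^sup>+ v. ennreal (gaussian_density 0 C v) * indicator A (\<mu> + v) \<partial>lborel)"
    by (simp add: gaussian_density_def)
  also have "\<dots> = (\<integral>\<^sup>+ v. indicator A (\<mu> + v) \<partial>gaussian 0 C)"
    unfolding gaussian_def by (subst nn_integral_density) auto
  also have "\<dots> = emeasure (distr (gaussian 0 C) borel (\<lambda>v. \<mu> + v)) A"
    by (subst nn_integral_distr[symmetric, where f = "indicator A" and M' = borel]) (auto simp: gaussian_def)
  finally show "emeasure (gaussian \<mu> C) A = emeasure (distr (gaussian 0 C) borel (\<lambda>v. \<mu> + v)) A" .
qed

section \<open>The quadratic form of the score\<close>

definition gram :: "real ^ 'n ^ 'n \<Rightarrow> ('d \<Rightarrow> real ^ 'n) \<Rightarrow> real ^ 'd ^ 'd" where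
  "gram K e = (\<chi> i j. e i \<bullet> (K *v e j))"

text \<open>
  These are covariant coordinates: the coefficients of \<open>v\<close> with respect to the \<open>e\<^sub>i\<close>, for \<open>v\<close> in their
  span, are obtained from them by inverting the Gram matrix. For \<open>e\<^sub>i\<close> the derivatives of the signal,
  \<open>K\<close> the inverse covariance and \<open>v\<close> the noise, this is the score.
\<close>

definition coords :: "real ^ 'n ^ 'n \<Rightarrow> ('d \<Rightarrow> real ^ 'n) \<Rightarrow> real ^ 'n \<Rightarrow> real ^ 'd" where
  "coords K e v = (\<chi> i. e i \<bullet> (K *v v))"

lemma coords_linear_combination:
  "coords K e (\<Sum>j\<in>UNIV. x $ j *\<^sub>R e j) = gram K e *v x"
  by (simp add: coords_def gram_def matrix_vector_mult_def[of "\<chi> i j. _ i j"]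
      linear_sum[OF matrix_vector_mul_linear] matrix_vector_mult_scaleR inner_sum_right mult.commute)

lemma inner_coords:
  "x \<bullet> coords K e v = (\<Sum>j\<in>UNIV. x $ j *\<^sub>R e j) \<bullet> (K *v v)"
  by (simp add: coords_def inner_vec_def[of x] inner_sum_left)

text \<open>
  The quadratic form \<open>x \<bullet> F x\<close> of the Gram matrix \<open>F\<close> is the \<open>K\<close>-square of \<open>\<Sum>\<^sub>j x\<^sub>j e\<^sub>j\<close>, so that a
  vanishing linear combination of the \<open>e\<^sub>j\<close> has zero coefficients.
\<close>

lemma dim_range_of_pos_def_gram:
  fixes e :: "'d::finite \<Rightarrow> real ^ 'n"
  assumes "pos_def (gram K e)"
  shows "dim (range e) = CARD('d)"
proof -
  have zero: "x = 0" if "(\<Sum>j\<in>UNIV. x $ j *\<^sub>R e j) = 0" for x :: "real ^ 'd"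
  proof -
    have "x \<bullet> (gram K e *v x) = 0"
      unfolding coords_linear_combination[symmetric] inner_coords that by simp
    then show ?thesis
      using assms by (metis less_irrefl pos_def_def)
  qed
  have inj: "inj e"
  proof (rule injI, rule ccontr)
    fix i j assume "e i = e j" "i \<noteq> j"
    then have "(\<Sum>l\<in>UNIV. (axis i 1 - axis j 1 :: real ^ 'd) $ l *\<^sub>R e l) = 0"
      by (simp add: axis_def scaleR_diff_left sum_subtractf if_distrib[of "\<lambda>c. c *\<^sub>R _"] cong: if_cong)
    then have "axis i 1 - axis j 1 = (0 :: real ^ 'd)"
      by (rule zero)
    then show False
      using \<open>i \<noteq> j\<close> by (simp add: axis_eq_axis)
  qed
  have "independent (range e)"
  proof (rule independent_if_scalars_zero)
    fix f x assume sum: "(\<Sum>x\<in>range e. f x *\<^sub>R x) = 0" and x: "x \<in> range e"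
    have "(\<Sum>j\<in>UNIV. (\<chi> j. f (e j)) $ j *\<^sub>R e j) = 0"
      using sum by (simp add: sum.reindex[OF inj])
    then have "(\<chi> j. f (e j)) = (0 :: real ^ 'd)"
      by (rule zero)
    then show "f x = 0"
      using x by (auto simp: vec_eq_iff)
  qed simp
  then show ?thesis
    by (simp add: dim_eq_card_independent card_image[OF inj])
qed

text \<open>
  With \<open>h = F\<^sup>-\<^sup>1 g\<close>, the equation \<open>F h = g\<close> is the normal equation of least squares, so
  \<open>p = \<Sum>\<^sub>j h\<^sub>j e\<^sub>j\<close> is the \<open>K\<close>-orthogonal projection of \<open>v\<close> onto the span of the \<open>e\<^sub>j\<close>. Both sides are
  its squared \<open>K\<close>-norm, once in terms of the \<open>e\<^sub>j\<close> and once in the orthonormal basis.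
\<close>

lemma score_quadratic_form_eq_sum_squares:
  fixes e :: "'d::finite \<Rightarrow> real ^ 'n" and w :: "'n \<Rightarrow> real ^ 'n"
  assumes K: "pos_def K" and F: "pos_def (gram K e)"
    and w: "\<And>i j. w i \<bullet> (K *v w j) = (if i = j then 1 else 0)"
    and span: "span (w ` I) = span (range e)"
  shows "coords K e v \<bullet> (matrix_inv (gram K e) *v coords K e v) = (\<Sum>i\<in>I. (w i \<bullet> (K *v v))\<^sup>2)"
proof -
  define h where "h = matrix_inv (gram K e) *v coords K e v"
  define p where "p = (\<Sum>j\<in>UNIV. h $ j *\<^sub>R e j)"
  have "coords K e p = coords K e v"
    unfolding p_def coords_linear_combination h_def pos_def_matrix_inv_mult_vec[OF F] ..
  then have normal: "e j \<bullet> (K *v p) = e j \<bullet> (K *v v)" for j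
    by (simp add: coords_def vec_eq_iff)
  have normal': "u \<bullet> (K *v p) = u \<bullet> (K *v v)" if "u \<in> span (range e)" for u
    using that by (induction rule: span_induct_alt) (auto simp: inner_add_left normal)
  have "p \<in> span (range e)"
    unfolding p_def by (intro span_sum span_scale span_base) auto
  then have pI: "p \<in> span (w ` I)"
    by (simp add: span)
  have wI: "w i \<bullet> (K *v p) = w i \<bullet> (K *v v)" if "i \<in> I" for i
    using that span span_base[of "w i" "w ` I"] by (intro normal') auto
  have "coords K e v \<bullet> h = p \<bullet> (K *v v)"
    unfolding p_def by (subst inner_commute) (rule inner_coords)
  also have "\<dots> = (\<Sum>i\<in>I. (w i \<bullet> (K *v p)) *\<^sub>R w i) \<bullet> (K *v v)"
    using orthonormal_family_expansion[where w = w and K = K, OF w pI] by simp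
  also have "\<dots> = (\<Sum>i\<in>I. (w i \<bullet> (K *v v))\<^sup>2)"
    by (simp add: inner_sum_left wI power2_eq_square)
  finally show ?thesis
    by (simp add: h_def)
qed

text \<open>
  The basis is adapted to the span of the \<open>e\<^sub>i\<close>, so that the sum of squares runs over \<open>d\<close> of the
  independent standard normal coordinates.
\<close>

lemma distr_score_quadratic_form:
  fixes e :: "'d::finite \<Rightarrow> real ^ 'n"
  assumes C: "pos_def C" and prob: "prob_space (gaussian 0 C)"
    and F: "pos_def (gram (matrix_inv C) e)"
  shows "distr (gaussian 0 C) borel
      (\<lambda>v. coords (matrix_inv C) e v \<bullet> (matrix_inv (gram (matrix_inv C) e) *v coords (matrix_inv C) e v))
    = chi_square CARD('d)"
proof -
  note K = pos_def_matrix_inv[OF C]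
  obtain w :: "'n \<Rightarrow> real ^ 'n" and I where
    ortho: "\<forall>i j. w i \<bullet> (matrix_inv C *v w j) = (if i = j then 1 else 0)"
    and I: "span (w ` I) = span (range e)" "card I = dim (range e)"
    by (rule orthonormal_basis_adapted[OF K, of "range e"]) simp_all
  from ortho have w: "w i \<bullet> (matrix_inv C *v w j) = (if i = j then 1 else 0)" for i j
    by blast
  let ?P = "PiM UNIV (\<lambda>_::'n. std_normal)"
  let ?T = "\<lambda>z. \<Sum>i\<in>UNIV. z i *\<^sub>R w i"
  have wT: "w i \<bullet> (matrix_inv C *v ?T z) = z i" for i z
    by (simp add: linear_sum[OF matrix_vector_mul_linear] matrix_vector_mult_scaleR inner_sum_right w
        if_distrib cong: if_cong)
  have "distr (gaussian 0 C) borel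
      (\<lambda>v. coords (matrix_inv C) e v \<bullet> (matrix_inv (gram (matrix_inv C) e) *v coords (matrix_inv C) e v))
    = distr (gaussian 0 C) borel (\<lambda>v. \<Sum>i\<in>I. (w i \<bullet> (matrix_inv C *v v))\<^sup>2)"
    by (simp add: score_quadratic_form_eq_sum_squares[OF K F w I(1)])
  also have "\<dots> = distr ?P borel ((\<lambda>v. \<Sum>i\<in>I. (w i \<bullet> (matrix_inv C *v v))\<^sup>2) \<circ> ?T)"
    unfolding gaussian_eq_distr_std_normal[OF prob w]
    by (intro distr_distr measurable_linear_combination) measurable
  also have "\<dots> = distr ?P borel (\<lambda>z. \<Sum>i\<in>I. (z i)\<^sup>2)"
    by (simp add: comp_def wT)
  also have "\<dots> = chi_square CARD('d)"
    using distr_sum_squares_std_normal[of UNIV I] I(2) dim_range_of_pos_def_gram[OF F] by simp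
  finally show ?thesis .
qed

section \<open>Fisher information and curvature\<close>

lemma has_bochner_integral_vec:
  fixes f :: "'a \<Rightarrow> 'b::euclidean_space ^ 'n"
  assumes "\<And>i. has_bochner_integral M (\<lambda>x. f x $ i) (c $ i)"
  shows "has_bochner_integral M f c"
proof -
  have lin: "bounded_linear (axis i :: 'b \<Rightarrow> 'b ^ 'n)" for i
    by (intro linear_conv_bounded_linear[THEN iffD1] linearI) (auto simp: axis_def vec_eq_iff)
  have eq: "v = (\<Sum>i\<in>UNIV. axis i (v $ i))" for v :: "'b ^ 'n"
    by (simp add: vec_eq_iff axis_def)
  have "has_bochner_integral M (\<lambda>x. \<Sum>i\<in>UNIV. axis i (f x $ i)) (\<Sum>i\<in>UNIV. axis i (c $ i))"
    by (intro has_bochner_integral_sum has_bochner_integral_bounded_linear[OF lin] assms)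
  then show ?thesis
    by (simp add: eq[symmetric])
qed

lemma has_bochner_integral_outer:
  assumes "\<And>i j. has_bochner_integral M (\<lambda>x. f x $ i * f x $ j) (A $ i $ j)"
  shows "has_bochner_integral M (\<lambda>x. outer (f x)) A"
  using assms by (intro has_bochner_integral_vec) (simp add: outer_def)

lemma partial_deriv_has_vector_derivative:
  assumes "f differentiable (at x)"
  shows "((\<lambda>t. f (x + t *\<^sub>R axis i 1)) has_vector_derivative partial_deriv i f x) (at 0)"
proof -
  have "(\<lambda>t. x + t *\<^sub>R axis i 1) differentiable (at (0::real))"
    by (intro derivative_intros)
  then have "(f \<circ> (\<lambda>t. x + t *\<^sub>R axis i 1)) differentiable (at (0::real))"
    using assms by (intro differentiable_chain_at) simp_all
  then show ?thesis
    by (simp add: partial_deriv_def vector_derivative_works[symmetric] comp_def)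
qed

lemma partial_deriv_eqI:
  fixes f :: "real ^ 'd \<Rightarrow> real"
  assumes "((\<lambda>t. f (x + t *\<^sub>R axis i 1)) has_real_derivative D) (at 0)"
  shows "partial_deriv i f x = D"
  using assms
  by (simp add: partial_deriv_def vector_derivative_at has_real_derivative_iff_has_vector_derivative)

context
  fixes K :: "real ^ 'n ^ 'n" and f :: "real \<Rightarrow> real ^ 'n" and e :: "real ^ 'n"
  assumes f: "(f has_vector_derivative e) (at 0)"
begin

lemma has_derivative_linear_form:
  "((\<lambda>t. f t \<bullet> a) has_real_derivative (e \<bullet> a)) (at 0)"
  using bounded_linear.has_vector_derivative[OF bounded_linear_inner_left f, of a]
  by (simp add: has_real_derivative_iff_has_vector_derivative)

lemma has_derivative_quadratic_form:
  assumes K: "pos_def K"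
  shows "((\<lambda>t. f t \<bullet> (K *v f t)) has_real_derivative 2 * (e \<bullet> (K *v f 0))) (at 0)"
proof -
  have bl: "bounded_linear (\<lambda>v. K *v v)"
    by (rule linear_conv_bounded_linear[THEN iffD1]) (rule matrix_vector_mul_linear)
  have "((\<lambda>t. f t \<bullet> (K *v f t)) has_vector_derivative (f 0 \<bullet> (K *v e) + e \<bullet> (K *v f 0))) (at 0)"
    by (intro bounded_bilinear.has_vector_derivative[OF bounded_bilinear_inner] f
        bounded_linear.has_vector_derivative[OF bl])
  then show ?thesis
    by (simp add: has_real_derivative_iff_has_vector_derivative pos_def_inner_commute[OF K, of "f 0" e])
qed

end

lemma snr_pos:
  assumes "pos_def C" "s x \<noteq> 0"
  shows "snr C s x > 0"
  using pos_def_matrix_inv[OF assms(1)] assms(2) by (simp add: snr_def pos_def_def)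

lemma snr_square:
  assumes "pos_def C" "s x \<noteq> 0"
  shows "(snr C s x)\<^sup>2 = s x \<bullet> (matrix_inv C *v s x)"
  using snr_pos[of C s x] assms by (simp add: snr_def)

context
  fixes C :: "real ^ 'n ^ 'n" and s :: "real ^ 'd \<Rightarrow> real ^ 'n" and x :: "real ^ 'd"
    and e :: "'d \<Rightarrow> real ^ 'n"
  assumes C: "pos_def C" and nz: "s x \<noteq> 0" and s: "s differentiable (at x)"
    and e: "\<And>i. e i = partial_deriv i s x"
begin

lemma partial_snr:
  "((\<lambda>t. snr C s (x + t *\<^sub>R axis i 1)) has_real_derivative
     e i \<bullet> (matrix_inv C *v s x) / snr C s x) (at 0)"
proof -
  note K = pos_def_matrix_inv[OF C]
  have pos: "s x \<bullet> (matrix_inv C *v s x) > 0"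
    using K nz by (simp add: pos_def_def)
  have "((\<lambda>t. s (x + t *\<^sub>R axis i 1) \<bullet> (matrix_inv C *v s (x + t *\<^sub>R axis i 1))) has_real_derivative
     2 * (e i \<bullet> (matrix_inv C *v s x))) (at 0)"
    using has_derivative_quadratic_form[OF partial_deriv_has_vector_derivative[OF s, of i] K]
    by (simp add: e)
  from DERIV_chain2[OF DERIV_real_sqrt this] show ?thesis
    using pos by (simp add: snr_def field_simps)
qed

lemma partial_linear_form:
  "((\<lambda>t. s (x + t *\<^sub>R axis i 1) \<bullet> a) has_real_derivative e i \<bullet> a) (at 0)"
  using has_derivative_linear_form[OF partial_deriv_has_vector_derivative[OF s, of i], of a]
  by (simp add: e)

text \<open>
  The derivative of \<open>r\<^sup>2 / 2\<close> is \<open>e\<^sub>i \<bullet> K s\<close>, which subtracts the signal from the measurement.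
\<close>

lemma grad_llr:
  "grad (llr C s m) x = coords (matrix_inv C) e (m - s x)"
proof -
  have "partial_deriv i (llr C s m) x = e i \<bullet> (matrix_inv C *v (m - s x))" for i
    unfolding llr_def[abs_def] using snr_pos[of C s x, OF C nz]
    by (intro partial_deriv_eqI)
       (auto intro!: derivative_eq_intros partial_linear_form partial_snr
         simp: power2_eq_square matrix_vector_mult_diff_distrib inner_diff_right)
  then show ?thesis
    by (simp add: grad_def coords_def)
qed

text \<open>
  Like the filter output itself, its derivative is linear in the noise, so that the curvature matrix is
  a covariance of two linear forms.
\<close>

lemma partial_filter_output:
  "partial_deriv i (filter_output C s n) x
   = ((1 / snr C s x) *\<^sub>R e i - ((e i \<bullet> (matrix_inv C *v s x)) / (snr C s x) ^ 3) *\<^sub>R s x)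
       \<bullet> (matrix_inv C *v n)"
  unfolding filter_output_def[abs_def] using snr_pos[of C s x, OF C nz]
  by (intro partial_deriv_eqI)
     (auto intro!: derivative_eq_intros partial_linear_form partial_snr
       simp: inner_diff_left field_simps power2_eq_square power3_eq_cube)

lemma partial_ln_snr:
  "partial_deriv i (\<lambda>x'. ln (snr C s x')) x = (e i \<bullet> (matrix_inv C *v s x)) / (snr C s x)\<^sup>2"
  using snr_pos[of C s x, OF C nz]
  by (intro partial_deriv_eqI)
     (auto intro!: derivative_eq_intros partial_snr simp: power2_eq_square)

text \<open>
  The normalizing constant of the density does not depend on the location, so only the quadratic
  exponent is differentiated.
\<close>

lemma grad_ln_gaussian_density:
  assumes prob: "prob_space (gaussian 0 C)"
  shows "grad (\<lambda>x'. ln (gaussian_density (s x') C m)) x = coords (matrix_inv C) e (m - s x)"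
proof -
  note K = pos_def_matrix_inv[OF C]
  let ?c = "sqrt ((2 * pi) ^ CARD('n) * det C)"
  have ln: "ln (gaussian_density \<mu> C m) = - ((m - \<mu>) \<bullet> (matrix_inv C *v (m - \<mu>))) / 2 - ln ?c" for \<mu>
    unfolding gaussian_density_def using gaussian_normalization_pos[OF prob] by (subst ln_div) auto
  have "partial_deriv i (\<lambda>x'. ln (gaussian_density (s x') C m)) x = e i \<bullet> (matrix_inv C *v (m - s x))" for i
  proof (rule partial_deriv_eqI)
    have "((\<lambda>t. m - s (x + t *\<^sub>R axis i 1)) has_vector_derivative 0 - e i) (at 0)"
      unfolding e
      by (intro has_vector_derivative_diff has_vector_derivative_const
          partial_deriv_has_vector_derivative[OF s])
    from has_derivative_quadratic_form[OF this K]
    have "((\<lambda>t. (m - s (x + t *\<^sub>R axis i 1)) \<bullet> (matrix_inv C *v (m - s (x + t *\<^sub>R axis i 1))))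
        has_real_derivative - (2 * (e i \<bullet> (matrix_inv C *v (m - s x))))) (at 0)"
      by simp
    then show "((\<lambda>t. ln (gaussian_density (s (x + t *\<^sub>R axis i 1)) C m))
        has_real_derivative e i \<bullet> (matrix_inv C *v (m - s x))) (at 0)"
      unfolding ln by (auto intro!: derivative_eq_intros)
  qed
  then show ?thesis
    by (simp add: grad_def coords_def)
qed

text \<open>
  The cross terms contribute \<open>-2\<close> and the square of the \<open>s x\<close> components \<open>+1\<close> times
  \<open>(e\<^sub>i \<bullet> K s) (e\<^sub>j \<bullet> K s) / r\<^sup>4\<close>. The remaining \<open>-1\<close> is what the gradient of \<open>log r\<close> compensates
  in \<open>Q\<close>.
\<close>

lemma curvature_eq:
  assumes prob: "prob_space (gaussian 0 C)"
  shows "curvature C s x $ i $ j = (e i \<bullet> (matrix_inv C *v e j)) / (snr C s x)\<^sup>2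
    - (e i \<bullet> (matrix_inv C *v s x)) * (e j \<bullet> (matrix_inv C *v s x)) / (snr C s x) ^ 4"
proof -
  define r where "r = snr C s x"
  define b where "b i = (1 / r) *\<^sub>R e i - ((e i \<bullet> (matrix_inv C *v s x)) / r ^ 3) *\<^sub>R s x" for i
  have r: "r > 0" "s x \<bullet> (matrix_inv C *v s x) = r\<^sup>2"
    using snr_pos[of C s x] snr_square[of C s x] C nz by (simp_all add: r_def)
  have "curvature C s x $ i $ j = b i \<bullet> (matrix_inv C *v b j)"
    using has_bochner_integral_integral_eq[OF gaussian_inverse_moments(2)[OF C prob, of "b i" "b j"]]
    by (simp add: curvature_def partial_filter_output b_def r_def)
  also have "\<dots> = (e i \<bullet> (matrix_inv C *v e j)) / r\<^sup>2
    - (e i \<bullet> (matrix_inv C *v s x)) * (e j \<bullet> (matrix_inv C *v s x)) / r ^ 4"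
    using r(1)
    by (simp add: b_def matrix_vector_mult_diff_distrib matrix_vector_mult_scaleR inner_diff_left
        inner_diff_right r(2) pos_def_inner_commute[OF pos_def_matrix_inv[OF C], of "s x" "e j"]
        divide_simps power2_eq_square power3_eq_cube power4_eq_xxxx)
  finally show ?thesis
    by (simp add: r_def)
qed

lemma snr_Q_matrix_eq_gram:
  assumes prob: "prob_space (gaussian 0 C)"
  shows "(snr C s x)\<^sup>2 *\<^sub>R Q_matrix C s x = gram (matrix_inv C) e"
  using snr_pos[of C s x, OF C nz]
  by (simp add: vec_eq_iff Q_matrix_def curvature_eq[OF prob] outer_def grad_def partial_ln_snr gram_def
      field_simps power2_eq_square power4_eq_xxxx)

lemma fisher_information_eq_gram:
  assumes prob: "prob_space (gaussian 0 C)"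
  shows "fisher_information C s x = gram (matrix_inv C) e"
proof -
  have "has_bochner_integral (gaussian 0 C) (\<lambda>v. outer (coords (matrix_inv C) e v)) (gram (matrix_inv C) e)"
    using gaussian_inverse_moments(2)[OF C prob]
    by (intro has_bochner_integral_outer) (simp add: coords_def gram_def)
  then have *: "(\<integral>v. outer (coords (matrix_inv C) e v) \<partial>gaussian 0 C) = gram (matrix_inv C) e"
    by (rule has_bochner_integral_integral_eq)
  have sets: "sets (gaussian 0 C) = sets borel"
    by (simp add: gaussian_def)
  have shift: "(\<lambda>v. s x + v) \<in> measurable (gaussian 0 C) borel"
    unfolding measurable_cong_sets[OF sets refl] by measurable
  have meas: "(\<lambda>m. outer (coords (matrix_inv C) e (m - s x))) \<in> borel_measurable borel"
  proof (intro borel_measurable_continuous_onI)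
    have "continuous_on UNIV (\<lambda>m. matrix_inv C *v (m - s x))"
      by (intro linear_continuous_on[THEN continuous_on_compose2, of "\<lambda>v. matrix_inv C *v v" UNIV]
          linear_conv_bounded_linear[THEN iffD1] matrix_vector_mul_linear continuous_intros) auto
    then show "continuous_on UNIV (\<lambda>m. outer (coords (matrix_inv C) e (m - s x)))"
      unfolding outer_def coords_def by (simp add: continuous_on_vec_lambda continuous_intros)
  qed
  have "fisher_information C s x
      = (\<integral>m. outer (coords (matrix_inv C) e (m - s x)) \<partial>distr (gaussian 0 C) borel (\<lambda>v. s x + v))"
    unfolding fisher_information_def grad_ln_gaussian_density[OF prob] gaussian_translate[of "s x"] ..
  also have "\<dots> = gram (matrix_inv C) e"
    unfolding integral_distr[OF shift meas] using * by simp
  finally show ?thesis .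
qed

end

lemma smooth_on_imp_differentiable:
  assumes "smooth_on S f" "x \<in> S"
  shows "f differentiable (at x)"
proof -
  have "Ck_on (Suc 0) S f"
    using assms(1) unfolding smooth_on_def by blast
  then show ?thesis
    using assms(2) by simp
qed

section \<open>Maximizing the quadratic log-likelihood ratio\<close>

text \<open>
  Completing the square leaves a constant minus a positive definite form in the deviation from
  \<open>x0 + F\<^sup>-\<^sup>1 g\<close>.
\<close>

lemma is_arg_max_concave_quadratic:
  fixes F :: "real ^ 'd ^ 'd" and f :: "real ^ 'd \<Rightarrow> real"
  assumes F: "pos_def F"
    and f: "\<And>x. f x = c + (x - x0) \<bullet> g - (x - x0) \<bullet> (F *v (x - x0)) / 2"
  shows "f x = c + g \<bullet> (matrix_inv F *v g) / 2
      - (x - (x0 + matrix_inv F *v g)) \<bullet> (F *v (x - (x0 + matrix_inv F *v g))) / 2"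
    and "is_arg_max f (\<lambda>_. True) x \<longleftrightarrow> x = x0 + matrix_inv F *v g"
proof -
  let ?h = "matrix_inv F *v g"
  have square: "f y = c + g \<bullet> ?h / 2 - (y - (x0 + ?h)) \<bullet> (F *v (y - (x0 + ?h))) / 2" for y
  proof -
    define u where "u = y - x0"
    have "?h \<bullet> (F *v u) = u \<bullet> g"
      using pos_def_inner_commute[OF F, of ?h u] by (simp add: pos_def_matrix_inv_mult_vec[OF F])
    then have "(u - ?h) \<bullet> (F *v (u - ?h)) = u \<bullet> (F *v u) - 2 * (u \<bullet> g) + g \<bullet> ?h"
      by (simp add: matrix_vector_mult_diff_distrib inner_diff_left inner_diff_right
          pos_def_matrix_inv_mult_vec[OF F] inner_commute[of g])
    moreover have shift: "y - (x0 + ?h) = u - ?h"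
      by (simp add: u_def)
    ultimately show ?thesis
      unfolding shift f u_def[symmetric] by linarith
  qed
  show "f x = c + g \<bullet> ?h / 2 - (x - (x0 + ?h)) \<bullet> (F *v (x - (x0 + ?h))) / 2"
    by (rule square)
  have top: "f (x0 + ?h) = c + g \<bullet> ?h / 2"
    unfolding square by simp
  have less: "f y < f (x0 + ?h)" if "y \<noteq> x0 + ?h" for y
    using F that unfolding top square[of y] pos_def_def by simp
  then show "is_arg_max f (\<lambda>_. True) x \<longleftrightarrow> x = x0 + ?h"
    unfolding is_arg_max_def by (metis less_asym)
qed

theorem theorem3:
  fixes M :: "'a measure"
    and C :: "real ^ 'n ^ 'n"
    and D :: "(real ^ 'd) set"
    and s :: "real ^ 'd \<Rightarrow> real ^ 'n"
    and xs :: "real ^ 'd"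
    and noise m :: "'a \<Rightarrow> real ^ 'n"
    and xm :: "'a \<Rightarrow> real ^ 'd"
    and lam_s lam_m :: "'a \<Rightarrow> real"
  assumes "prob_space M"
    and "pos_def C"
    and "distributed M lborel noise (\<lambda>v. ennreal (gaussian_density 0 C v))"
    and "open D"
    and "smooth_on D s"
    and "\<And>x. x \<in> D \<Longrightarrow> s x \<noteq> 0"
    and "\<And>x. x \<in> D \<Longrightarrow> pos_def (Q_matrix C s x)"
    and "xs \<in> D"
    and "\<And>\<omega>. m \<omega> = s xs + noise \<omega>"
    and "\<And>\<omega>. xm \<omega> = location_estimate C s xs (m \<omega>)"
    and "\<And>\<omega>. lam_s \<omega> = llr C s (m \<omega>) xs"
    and "\<And>\<omega>. lam_m \<omega> = high_snr_llr C s xs (m \<omega>) (xm \<omega>)"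
  shows "(\<forall>\<omega>. \<exists>!x. is_arg_max (high_snr_llr C s xs (m \<omega>)) (\<lambda>_. True) x)
    \<and> invertible (fisher_information C s xs)
    \<and> has_bochner_integral M (\<lambda>\<omega>. outer (xm \<omega> - xs)) (cramer_rao_bound C s xs)
    \<and> cramer_rao_bound C s xs = inverse ((snr C s xs)\<^sup>2) *\<^sub>R matrix_inv (Q_matrix C s xs)
    \<and> (\<forall>\<omega>. lam_m \<omega> - lam_s \<omega> =
          1 / 2 * ((xm \<omega> - xs) \<bullet> (((snr C s xs)\<^sup>2 *\<^sub>R Q_matrix C s xs) *v (xm \<omega> - xs))))
    \<and> (\<lambda>\<omega>. 2 * (lam_m \<omega> - lam_s \<omega>)) \<in> borel_measurable M
    \<and> distr M borel (\<lambda>\<omega>. 2 * (lam_m \<omega> - lam_s \<omega>)) = chi_square CARD('d)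
    \<and> prob_space.expectation M (\<lambda>\<omega>. 2 * (lam_m \<omega> - lam_s \<omega>)) = real CARD('d)
    \<and> prob_space.variance M (\<lambda>\<omega>. 2 * (lam_m \<omega> - lam_s \<omega>)) = 2 * real CARD('d)
    \<and> integrable M lam_s
    \<and> integrable M lam_m
    \<and> prob_space.expectation M lam_m = prob_space.expectation M lam_s + real CARD('d) / 2
    \<and> prob_space.expectation M lam_s + real CARD('d) / 2
        = (snr C s xs)\<^sup>2 / 2 + real CARD('d) / 2"
proof -
  interpret prob_space M by fact
  note C = \<open>pos_def C\<close>
  define K where "K = matrix_inv C"
  define r where "r = snr C s xs"
  define e where "e i = partial_deriv i s xs" for i
  define F where "F = gram K e"
  have nz: "s xs \<noteq> 0" and Q: "pos_def (Q_matrix C s xs)"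
    using assms(6,7) \<open>xs \<in> D\<close> by auto
  have r: "r > 0" "r\<^sup>2 = s xs \<bullet> (K *v s xs)"
    using snr_pos[of C s xs] snr_square[of C s xs] C nz by (simp_all add: r_def K_def)
  have diff: "s differentiable (at xs)"
    using assms(5) \<open>xs \<in> D\<close> by (rule smooth_on_imp_differentiable)

  have noise[measurable]: "noise \<in> measurable M borel"
    using distributed_measurable[OF assms(3)] by simp
  have law: "distr M borel noise = gaussian 0 C"
    using distributed_distr_eq_density[OF assms(3)] by (simp add: gaussian_def cong: distr_cong)
  \<comment> \<open>As the law of a random vector, the Gaussian measure is normalized.\<close>
  have prob: "prob_space (gaussian 0 C)"
    unfolding law[symmetric] by (rule prob_space_distr) measurable
  have transfer: "has_bochner_integral M (\<lambda>\<omega>. f (noise \<omega>)) c"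
    if "has_bochner_integral (gaussian 0 C) f c" for f :: "real ^ 'n \<Rightarrow> real" and c
  proof -
    have f: "f \<in> borel_measurable borel"
      using borel_measurable_has_bochner_integral[OF that] by (simp add: gaussian_def)
    then show ?thesis
      using that integrable_distr_eq[OF noise f] integral_distr[OF noise f]
      unfolding law[symmetric] by (simp add: has_bochner_integral_iff)
  qed

  have F_Q: "r\<^sup>2 *\<^sub>R Q_matrix C s xs = F"
    unfolding r_def F_def K_def by (rule snr_Q_matrix_eq_gram[OF C nz diff e_def prob])
  have F: "pos_def F"
    unfolding F_Q[symmetric] using Q r(1) by (intro pos_def_scaleR) auto
  have fisher: "fisher_information C s xs = F"
    unfolding F_def K_def by (rule fisher_information_eq_gram[OF C nz diff e_def prob])

  define g where "g \<omega> = coords K e (noise \<omega>)" for \<omega>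
  have score: "grad (llr C s (m \<omega>)) xs = g \<omega>" for \<omega>
    unfolding g_def K_def using grad_llr[OF C nz diff e_def, of "m \<omega>"] by (simp add: assms(9))
  have llr: "high_snr_llr C s xs (m \<omega>) x = lam_s \<omega> + (x - xs) \<bullet> g \<omega> - (x - xs) \<bullet> (F *v (x - xs)) / 2"
    for \<omega> x
    by (simp add: high_snr_llr_def score assms(11) F_Q[symmetric] r_def
        scaleR_matrix_vector_assoc[symmetric])
  note quadratic = is_arg_max_concave_quadratic[OF F llr]
  \<comment> \<open>The estimate is an arbitrary choice among the maximizers, of which there is only one.\<close>
  have xm: "xm \<omega> = xs + matrix_inv F *v g \<omega>" for \<omega>
    unfolding assms(10) location_estimate_def arg_max_def quadratic(2) by simp
  have error: "xm \<omega> - xs = matrix_inv F *v g \<omega>" for \<omega>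
    by (simp add: xm)
  have excess: "2 * (lam_m \<omega> - lam_s \<omega>) = g \<omega> \<bullet> (matrix_inv F *v g \<omega>)" for \<omega>
    unfolding assms(12) quadratic(1) xm by simp

  have unique_max: "\<forall>\<omega>. \<exists>!x. is_arg_max (high_snr_llr C s xs (m \<omega>)) (\<lambda>_. True) x"
    unfolding quadratic(2) by simp
  have fisher_inv: "invertible (fisher_information C s xs)"
    unfolding fisher by (rule pos_def_invertible[OF F])

  have bound: "cramer_rao_bound C s xs = inverse ((snr C s xs)\<^sup>2) *\<^sub>R matrix_inv (Q_matrix C s xs)"
  proof -
    have "F ** (inverse (r\<^sup>2) *\<^sub>R matrix_inv (Q_matrix C s xs)) = mat 1"
      unfolding F_Q[symmetric] using r(1) pos_def_matrix_inv_mult[OF Q]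
      by (simp add: matrix_scalar_ac scalar_matrix_assoc)
    then have "matrix_inv F ** (F ** (inverse (r\<^sup>2) *\<^sub>R matrix_inv (Q_matrix C s xs))) = matrix_inv F"
      by simp
    then show ?thesis
      unfolding cramer_rao_bound_def fisher r_def[symmetric]
      by (simp add: matrix_mul_assoc pos_def_matrix_inv_mult[OF F])
  qed
  have covariance: "has_bochner_integral M (\<lambda>\<omega>. outer (xm \<omega> - xs)) (cramer_rao_bound C s xs)"
    unfolding cramer_rao_bound_def fisher error
  proof (rule has_bochner_integral_outer)
    fix i j
    \<comment> \<open>The component \<open>i\<close> of the error is the linear form \<open>a\<^sub>i \<bullet> K n\<close> in the noise, where the \<open>a\<^sub>i\<close>
       are the dual vectors of the \<open>e\<^sub>j\<close>: \<open>e\<^sub>i \<bullet> K a\<^sub>j\<close> is \<open>1\<close> if \<open>i = j\<close> and \<open>0\<close> otherwise.\<close>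
    define a where "a i = (\<Sum>l\<in>UNIV. (matrix_inv F $ i) $ l *\<^sub>R e l)" for i
    have comp: "(matrix_inv F *v g \<omega>) $ i = a i \<bullet> (K *v noise \<omega>)" for \<omega> i
      unfolding matrix_vector_mul_component g_def inner_coords a_def ..
    have "coords K e (a j) = F *v (matrix_inv F $ j)"
      unfolding a_def coords_linear_combination F_def ..
    also have "matrix_inv F $ j = matrix_inv F *v axis j 1"
    proof -
      have "transpose (matrix_inv F) = matrix_inv F"
        using pos_def_matrix_inv[OF F] by (simp add: pos_def_def)
      then have "matrix_inv F *v axis j 1 = column j (transpose (matrix_inv F))"
        by (simp add: matrix_vector_mult_basis)
      then show ?thesis
        by (simp add: column_def transpose_def vec_eq_iff)
    qed
    also have "F *v \<dots> = axis j 1"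
      by (rule pos_def_matrix_inv_mult_vec[OF F])
    finally have "a i \<bullet> (K *v a j) = (matrix_inv F) $ i $ j"
      unfolding a_def[of i] inner_coords[symmetric] by (simp add: inner_axis)
    then show "has_bochner_integral M
        (\<lambda>\<omega>. (matrix_inv F *v g \<omega>) $ i * (matrix_inv F *v g \<omega>) $ j) (matrix_inv F $ i $ j)"
      unfolding comp using transfer[OF gaussian_inverse_moments(2)[OF C prob, of "a i" "a j"]]
      by (simp add: K_def)
  qed
  have peak: "\<forall>\<omega>. lam_m \<omega> - lam_s \<omega> =
      1 / 2 * ((xm \<omega> - xs) \<bullet> (((snr C s xs)\<^sup>2 *\<^sub>R Q_matrix C s xs) *v (xm \<omega> - xs)))"
  proof
    fix \<omega>
    show "lam_m \<omega> - lam_s \<omega> =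
      1 / 2 * ((xm \<omega> - xs) \<bullet> (((snr C s xs)\<^sup>2 *\<^sub>R Q_matrix C s xs) *v (xm \<omega> - xs)))"
      unfolding r_def[symmetric] F_Q error pos_def_matrix_inv_mult_vec[OF F]
      using excess[of \<omega>] by (simp add: inner_commute)
  qed

  define q where "q v = coords K e v \<bullet> (matrix_inv F *v coords K e v)" for v
  have q: "2 * (lam_m \<omega> - lam_s \<omega>) = q (noise \<omega>)" for \<omega>
    unfolding excess g_def q_def ..
  have [measurable]: "q \<in> borel_measurable borel"
  proof -
    have "q = (\<lambda>v. \<Sum>i\<in>UNIV. \<Sum>j\<in>UNIV. (e i \<bullet> (K *v v)) * (matrix_inv F $ i $ j * (e j \<bullet> (K *v v))))"
      by (simp add: fun_eq_iff q_def coords_def inner_vec_def[where 'b = 'd] matrix_vector_mult_def[of "matrix_inv F"] sum_distrib_left)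
    also have "\<dots> \<in> borel_measurable borel" by measurable
    finally show ?thesis .
  qed
  have meas: "(\<lambda>\<omega>. 2 * (lam_m \<omega> - lam_s \<omega>)) \<in> borel_measurable M"
    unfolding q by measurable
  have chi: "distr M borel (\<lambda>\<omega>. 2 * (lam_m \<omega> - lam_s \<omega>)) = chi_square CARD('d)"
  proof -
    have "distr M borel (\<lambda>\<omega>. q (noise \<omega>)) = distr (distr M borel noise) borel q"
      by (simp add: distr_distr comp_def)
    also have "\<dots> = chi_square CARD('d)"
      unfolding law q_def F_def K_def using F
      by (intro distr_score_quadratic_form[OF C prob]) (simp add: F_def K_def)
    finally show ?thesis
      unfolding q .
  qed
  have chi_int: "has_bochner_integral M (\<lambda>\<omega>. f (2 * (lam_m \<omega> - lam_s \<omega>))) c"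
    if "has_bochner_integral (chi_square CARD('d)) f c" "f \<in> borel_measurable borel"
    for f :: "real \<Rightarrow> real" and c
    using that integrable_distr_eq[OF meas that(2)] integral_distr[OF meas that(2)]
    unfolding chi[symmetric] by (simp add: has_bochner_integral_iff)
  have mean: "has_bochner_integral M (\<lambda>\<omega>. 2 * (lam_m \<omega> - lam_s \<omega>)) (real CARD('d))"
    by (rule chi_int[OF chi_square_moments(1)]) simp
  have second: "has_bochner_integral M (\<lambda>\<omega>. (2 * (lam_m \<omega> - lam_s \<omega>))\<^sup>2)
      ((real CARD('d))\<^sup>2 + 2 * real CARD('d))"
    by (rule chi_int[OF chi_square_moments(2)]) simp
  have var: "variance (\<lambda>\<omega>. 2 * (lam_m \<omega> - lam_s \<omega>)) = 2 * real CARD('d)"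
  proof -
    have int: "integrable M (\<lambda>\<omega>. 2 * (lam_m \<omega> - lam_s \<omega>))"
      "integrable M (\<lambda>\<omega>. (2 * (lam_m \<omega> - lam_s \<omega>))\<^sup>2)"
      using mean second unfolding has_bochner_integral_iff by blast+
    note variance_eq[OF int]
    also have "expectation (\<lambda>\<omega>. (2 * (lam_m \<omega> - lam_s \<omega>))\<^sup>2)
        - (expectation (\<lambda>\<omega>. 2 * (lam_m \<omega> - lam_s \<omega>)))\<^sup>2 = 2 * real CARD('d)"
      unfolding has_bochner_integral_integral_eq[OF mean] has_bochner_integral_integral_eq[OF second]
      by simp
    finally show ?thesis .
  qed

  have lam_s: "has_bochner_integral M lam_s (r\<^sup>2 / 2)"
  proof -
    have eq: "lam_s \<omega> = r\<^sup>2 / 2 + s xs \<bullet> (K *v noise \<omega>)" for \<omega>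
      by (simp add: assms(9,11) llr_def r_def[symmetric] K_def[symmetric] r(2)
          matrix_vector_right_distrib inner_add_right)
    have "has_bochner_integral M (\<lambda>\<omega>. r\<^sup>2 / 2 + s xs \<bullet> (K *v noise \<omega>)) (r\<^sup>2 / 2 + 0)"
      using transfer[OF gaussian_inverse_moments(1)[OF C prob, of "s xs"]]
      by (intro has_bochner_integral_add) (auto simp: K_def has_bochner_integral_iff prob_space)
    then show ?thesis
      unfolding eq[symmetric] by simp
  qed
  have eq: "lam_s \<omega> + 1 / 2 * (2 * (lam_m \<omega> - lam_s \<omega>)) = lam_m \<omega>" for \<omega>
    by (simp add: field_simps)
  have "has_bochner_integral M (\<lambda>\<omega>. lam_s \<omega> + 1 / 2 * (2 * (lam_m \<omega> - lam_s \<omega>)))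
      (r\<^sup>2 / 2 + 1 / 2 * real CARD('d))"
    by (intro has_bochner_integral_add lam_s has_bochner_integral_mult_right mean)
  then have lam_m: "has_bochner_integral M lam_m (r\<^sup>2 / 2 + real CARD('d) / 2)"
    unfolding eq by simp
  have integrals: "integrable M lam_s" "integrable M lam_m"
    "expectation lam_s = r\<^sup>2 / 2" "expectation lam_m = r\<^sup>2 / 2 + real CARD('d) / 2"
    using lam_s lam_m by (simp_all add: has_bochner_integral_iff)
  show ?thesis
    using integrals
    by (intro conjI unique_max fisher_inv covariance bound peak meas chi var has_bochner_integral_integral_eq[OF mean])
       (simp_all add: r_def)
qed

end
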